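(* Let $\widetilde f_M$ be one of the four bagged predictors $\widetilde f^{\mathrm{WR}}_{M,\mathcal I_k}$, $\widetilde f^{\mathrm{WOR}}_{M,\mathcal I_k}$, $\widetilde f^{\mathrm{WR}}_{M,\mathcal I_k^\pi}$, $\widetilde f^{\mathrm{WOR}}_{M,\mathcal I_k^\pi}$. Suppose there exist non-stochastic numbers $b_1,b_2$ such that, as $n\to\infty$, $$|R(\widetilde f_1;\mathcal D_n,I^{(n)})-b_1|\xrightarrow{a.s.}0\quad\text{for all (sequences) } I^{(n)}\in\mathcal I_k \text{ (resp. } \mathcal I_k^\pi),$$ $$|R(\widetilde f_2;\mathcal D_n,\{I_1^{(n)},I_2^{(n)}\})-b_2|\xrightarrow{a.s.}0\quad\text{for random samples } I_1^{(n)},I_2^{(n)}$$ drawn by the sampling scheme (with or without replacement, from $\mathcal I_k$ or $\mathcal I_k^\pi$) used to define $\widetilde f_M$, where almost sure convergence is with respect to the randomness of both $\mathcal D_n$ and the index sets. Then: (a) (Subsample conditional risk) for $\{I_\ell\}_{\ell=1}^M$ a simple random sample according to the definition of $\widetilde f_M$, $$\sup_{M\in\mathbb N}\left|R(\widetilde f_M;\mathcal D_n,\{I_\ell\}_{\ell=1}^M)-\left[(2b_2-b_1)+\frac{2(b_1-b_2)}{M}\right]\right|\xrightarrow{p}0;$$ (b) (Data conditional risk) $$\sup_{M\in\mathbb N}\left|R(\widetilde f_M;\mathcal D_n)-\left[(2b_2-b_1)+\frac{2(b_1-b_2)}{M}\right]\right|\xrightarrow{a.s.}0 .$$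
   Context: Let $\mathcal D_n=\{(x_1,y_1),\dots,(x_n,y_n)\}$ be a random dataset in $\mathbb R^p\times\mathbb R$ and let $P$ denote the distribution of an independent test point $(x,y)$. A prediction procedure $\widehat f$ maps $(x,\mathcal D)$, with $x\in\mathbb R^p$ and $\mathcal D\subseteq\mathcal D_n$, to $\widehat f(x;\mathcal D)\in\mathbb R$. For $I\subseteq\{1,\dots,n\}$, $\mathcal D_I=\{(x_j,y_j):j\in I\}$. For $k\in\{1,\dots,n\}$ (allowed to depend on $n$), $\mathcal I_k$ is the set of all $k$-element subsets of $\{1,\dots,n\}$; for a fixed permutation $\pi$ of $\{1,\dots,n\}$, $\mathcal I_k^\pi=\{\{\pi((j-1)k+1),\dots,\pi(jk)\}:1\le j\le\lfloor n/k\rfloor\}$. The bagged predictor with $M$ bags is $\widetilde f_M(x;\{\mathcal D_{I_\ell}\}_{\ell=1}^M)=\frac1M\sum_{\ell=1}^M\widehat f(x;\mathcal D_{I_\ell})$, where $I_1,\dots,I_M$, independent of $\mathcal D_n$, form a simple random sample from $\mathcal I_k$ or $\mathcal I_k^\pi$, drawn with replacement (superscript WR: i.i.d. uniform draws) or without replacement (superscript WOR). For WOR, the supremum over $M\in\mathbb N$ is understood as over $M\le|\mathcal I_k|$ (resp. $M\le|\mathcal I_k^\pi|$). Subsample conditional risk: $R(\widetilde f_M;\mathcal D_n,\{I_\ell\}_{\ell=1}^M)=\int (y-\widetilde f_M(x;\{\mathcal D_{I_\ell}\}))^2\,dP(x,y)$. Data conditional risk: $R(\widetilde f_M;\mathcal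 D_n)=\int\mathbb E[(y-\widetilde f_M(x;\{\mathcal D_{I_\ell}\}))^2\mid\mathcal D_n]\,dP(x,y)$, where the inner expectation is over the random draw of $I_1,\dots,I_M$ only. $R(\widetilde f_1;\mathcal D_n,I)$ is the $M=1$ subsample conditional risk with $I_1=I$. *)

theory Defs
  imports "HOL-Probability.Probability" "HOL-Combinatorics.Permutations"
begin

text \<open>
  A vector in the \<open>p\<close>-dimensional space is an extensional function on \<open>{1..p}\<close>, so that the
  dimension can be an ordinary number and may change with the sample size.  An observation is a
  pair \<open>(x, y)\<close>; a dataset of size \<open>n\<close> is an extensional function on \<open>{1..n}\<close>.
\<close>

type_synonym obs = "(nat \<Rightarrow> real) \<times> real"

definition feature_space :: "nat \<Rightarrow> (nat \<Rightarrow> real) measure" where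
  "feature_space p = (\<Pi>\<^sub>M i\<in>{1..p}. borel)"

definition obs_space :: "nat \<Rightarrow> obs measure" where
  "obs_space p = feature_space p \<Otimes>\<^sub>M borel"

definition data_space :: "nat \<Rightarrow> nat \<Rightarrow> (nat \<Rightarrow> obs) measure" where
  "data_space n p = (\<Pi>\<^sub>M j\<in>{1..n}. obs_space p)"

text \<open>
  The subdataset indexed by \<open>S\<close>.  It is a multiset, so that coinciding observations are kept;
  procedures acting on plain sets of observations are those that factor through \<^const>\<open>set_mset\<close>.
\<close>

definition subdata :: "(nat \<Rightarrow> obs) \<Rightarrow> nat set \<Rightarrow> obs multiset" where
  "subdata d S = image_mset d (mset_set S)"

type_synonym predictor = "(nat \<Rightarrow> real) \<Rightarrow> obs multiset \<Rightarrow> real"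

definition k_subsets :: "nat \<Rightarrow> nat \<Rightarrow> nat set set" where
  "k_subsets n k = {S. S \<subseteq> {1..n} \<and> card S = k}"

definition perm_blocks :: "nat \<Rightarrow> nat \<Rightarrow> (nat \<Rightarrow> nat) \<Rightarrow> nat set set" where
  "perm_blocks n k \<pi> = (\<lambda>j. \<pi> ` {(j - 1) * k + 1..j * k}) ` {1..n div k}"

datatype scheme = WR | WOR

text \<open>The possible sample sizes \<open>M\<close>, at the same time the possible draw numbers.\<close>

definition sizes :: "scheme \<Rightarrow> nat set set \<Rightarrow> nat set" where
  "sizes s A = (case s of WR \<Rightarrow> {1..} | WOR \<Rightarrow> {1..card A})"

text \<open>
  The law of \<open>M\<close> draws from \<open>A\<close>.  A sample is an extensional function on \<open>{1..M}\<close>, whence the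
  default value \<^const>\<open>undefined\<close> in the product of uniform distributions.
\<close>

definition draw_pmf :: "scheme \<Rightarrow> nat set set \<Rightarrow> nat \<Rightarrow> (nat \<Rightarrow> nat set) pmf" where
  "draw_pmf s A M =
     (case s of
        WR \<Rightarrow> Pi_pmf {1..M} undefined (\<lambda>_. pmf_of_set A)
      | WOR \<Rightarrow> pmf_of_set {S \<in> {1..M} \<rightarrow>\<^sub>E A. inj_on S {1..M}})"

definition draw_space :: "nat set set \<Rightarrow> nat set \<Rightarrow> (nat \<Rightarrow> nat set) measure" where
  "draw_space A L = (\<Pi>\<^sub>M l\<in>L. count_space A)"

text \<open>
  \<open>X\<close> is a sequence of draws with draw numbers in the initial segment \<open>L\<close> of the positive integers;
  every prefix \<open>(X 1, \<dots>, X M)\<close> is a simple random sample of size \<open>M\<close>.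
\<close>

definition simple_random_sample ::
    "'w measure \<Rightarrow> scheme \<Rightarrow> nat set set \<Rightarrow> nat set \<Rightarrow> ('w \<Rightarrow> nat \<Rightarrow> nat set) \<Rightarrow> bool" where
  "simple_random_sample \<Omega> s A L X \<longleftrightarrow>
     X \<in> \<Omega> \<rightarrow>\<^sub>M draw_space A L \<and>
     (\<forall>M\<in>L. distr \<Omega> (count_space UNIV) (\<lambda>\<omega>. restrict (X \<omega>) {1..M}) = measure_pmf (draw_pmf s A M))"

text \<open>
  Same as \<^const>\<open>prob_space.indep_var\<close>, which however requires both variables to take values in the
  same type.
\<close>

definition indep_rv ::
    "'w measure \<Rightarrow> 'a measure \<Rightarrow> ('w \<Rightarrow> 'a) \<Rightarrow> 'b measure \<Rightarrow> ('w \<Rightarrow> 'b) \<Rightarrow> bool" where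
  "indep_rv \<Omega> N X N' Y \<longleftrightarrow>
     X \<in> \<Omega> \<rightarrow>\<^sub>M N \<and> Y \<in> \<Omega> \<rightarrow>\<^sub>M N' \<and>
     prob_space.indep_set \<Omega>
       {X -` B \<inter> space \<Omega> | B. B \<in> sets N} {Y -` B \<inter> space \<Omega> | B. B \<in> sets N'}"

definition bagged ::
    "predictor \<Rightarrow> (nat \<Rightarrow> obs) \<Rightarrow> nat \<Rightarrow> (nat \<Rightarrow> nat set) \<Rightarrow> (nat \<Rightarrow> real) \<Rightarrow> real" where
  "bagged f d M S x = (\<Sum>l=1..M. f x (subdata d (S l))) / real M"

text \<open>
  The risks are integrals of nonnegative functions and are allowed to be infinite, so no
  integrability needs to be assumed.
\<close>

definition subsample_risk ::
    "obs measure \<Rightarrow> predictor \<Rightarrow> (nat \<Rightarrow> obs) \<Rightarrow> nat \<Rightarrow> (nat \<Rightarrow> nat set) \<Rightarrow> ennreal" where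
  "subsample_risk P f d M S = (\<integral>\<^sup>+ (x, y). ennreal ((y - bagged f d M S x)\<^sup>2) \<partial>P)"

text \<open>
  Because the draws are independent of the data, the expectation over the draws given the data is
  the integral with respect to their law, the data \<open>d\<close> being held fixed.
\<close>

definition data_risk ::
    "obs measure \<Rightarrow> predictor \<Rightarrow> (nat \<Rightarrow> obs) \<Rightarrow> scheme \<Rightarrow> nat set set \<Rightarrow> nat \<Rightarrow> ennreal" where
  "data_risk P f d s A M =
     (\<integral>\<^sup>+ (x, y). (\<integral>\<^sup>+ S. ennreal ((y - bagged f d M S x)\<^sup>2) \<partial>measure_pmf (draw_pmf s A M)) \<partial>P)"

definition deviation :: "ennreal \<Rightarrow> real \<Rightarrow> ereal" where
  "deviation r c = \<bar>enn2ereal r - ereal c\<bar>"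

definition tendsto_0_in_prob :: "'w measure \<Rightarrow> (nat \<Rightarrow> 'w \<Rightarrow> ereal) \<Rightarrow> bool" where
  "tendsto_0_in_prob \<Omega> X \<longleftrightarrow>
     (\<forall>\<^sub>F n in sequentially. X n \<in> borel_measurable \<Omega>) \<and>
     (\<forall>\<epsilon>>0. (\<lambda>n. measure \<Omega> {\<omega> \<in> space \<Omega>. \<bar>X n \<omega>\<bar> > ereal \<epsilon>}) \<longlonglongrightarrow> 0)"

end

theory Submission
  imports Defs
begin

text \<open>
  For fixed data write \<open>e\<^sub>B\<close> for the residual of the predictor trained on the bag \<open>B\<close> and
  \<open>c(B, C)\<close> for the mean of \<open>e\<^sub>B e\<^sub>C\<close> over a test point.  The residual of a bagged predictor is the
  average of the residuals of its bags, so its risk is the average of \<open>c(I\<^sub>i, I\<^sub>j)\<close> over all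
  \<open>1 \<le> i, j \<le> M\<close>.  If the \<open>M\<close> diagonal terms are close to \<open>b1\<close> and the \<open>M (M - 1)\<close> off-diagonal
  ones are on average close to \<open>\<gamma> = 2 b2 - b1\<close>, then the risk is close to \<open>\<gamma> + (b1 - \<gamma>) / M\<close>, which
  is the claimed profile.  The error is at most the largest diagonal error plus a U-statistic with
  the kernel \<open>g(B, C) = \<bar>c(B, C) - \<gamma>\<bar>\<close> (\<open>subsample_risk_deviation_le\<close>).

  The diagonal error tends to \<open>0\<close> uniformly over all bags because the hypothesis on single risks
  covers random bags that depend on the data, in particular the worst bag
  (\<open>uniform_convergence_of_random_selections\<close>).  For the off-diagonal error, the hypothesis on pairs
  and polarization give \<open>g(J\<^sub>1, J\<^sub>2) \<rightarrow> 0\<close> almost surely.  By independence of data and draws this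
  holds for almost all data and, these being fixed, for almost all draws; since \<open>g\<close> is eventually
  bounded, the mean \<open>\<eta>\<close> of \<open>g\<close> over the draw of a pair tends to \<open>0\<close> for almost all data
  (\<open>pair_deviation_tendsto_0\<close>).

  Both schemes of sampling are exchangeable.  The U-statistics of all sizes \<open>M \<ge> 2\<close> therefore have
  mean \<open>\<eta>\<close> under the draws, and averaging the error bound proves the claim on the data conditional
  risk (\<open>data_risk_deviation_le\<close>).  For the subsample conditional risk the supremum over \<open>M\<close> stands
  inside the probability.  It is controlled by a maximal inequality,
  the probability that some U-statistic exceeds \<open>\<epsilon>\<close> being at most \<open>\<eta> / \<epsilon>\<close>
  (\<open>u_statistic_maximal_inequality\<close>); this bound on the conditional probability given the data tends
  to \<open>0\<close> almost surely, and integrating over the data gives convergence in probability.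
\<close>

section \<open>Exchangeable samples\<close>

definition samples :: "scheme \<Rightarrow> nat set set \<Rightarrow> nat \<Rightarrow> (nat \<Rightarrow> nat set) set" where
  "samples s A M = {S \<in> {1..M} \<rightarrow>\<^sub>E A. s = WOR \<longrightarrow> inj_on S {1..M}}"

lemma finite_samples: "finite A \<Longrightarrow> finite (samples s A M)"
  unfolding samples_def by (rule finite_subset[of _ "{1..M} \<rightarrow>\<^sub>E A"]) (auto intro: finite_PiE)

lemma samples_nonempty:
  assumes "finite A" "A \<noteq> {}" "M \<in> sizes s A"
  shows "samples s A M \<noteq> {}"
proof (cases s)
  case WR
  then show ?thesis using assms(2) by (auto simp: samples_def PiE_eq_empty_iff)
next
  case WOR
  then have "card {1..M} \<le> card A" using assms(3) by (simp add: sizes_def)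
  then obtain f where f: "f ` {1..M} \<subseteq> A" "inj_on f {1..M}"
    using card_le_inj[of "{1..M}" A] assms(1) by auto
  then have "restrict f {1..M} \<in> samples s A M"
    by (auto simp: samples_def intro: inj_on_restrict_eq[THEN iffD2])
  then show ?thesis by auto
qed

text \<open>
  Sampling with replacement is uniform on all functions, so both schemes become uniform laws on a
  set of functions.  Every symmetry of that set is then a symmetry of the law.
\<close>

lemma draw_pmf_uniform:
  assumes "finite A" "A \<noteq> {}"
  shows "draw_pmf s A M = pmf_of_set (samples s A M)"
proof (cases s)
  case WR
  have "PiE_dflt {1..M} undefined (\<lambda>_. A) = {1..M} \<rightarrow>\<^sub>E A"
    unfolding PiE_dflt_def PiE_def extensional_def by auto
  then show ?thesis
    using assms WR by (simp add: draw_pmf_def samples_def Pi_pmf_of_set)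
next
  case WOR
  then show ?thesis by (simp add: draw_pmf_def samples_def)
qed

lemma set_draw_pmf:
  assumes "finite A" "A \<noteq> {}" "M \<in> sizes s A"
  shows "set_pmf (draw_pmf s A M) = samples s A M"
  using assms by (simp add: draw_pmf_uniform samples_nonempty finite_samples)

lemma samples_comp_permutes:
  assumes "\<sigma> permutes {1..M}" "S \<in> samples s A M"
  shows "S \<circ> \<sigma> \<in> samples s A M"
proof -
  have "S \<circ> \<sigma> \<in> {1..M} \<rightarrow>\<^sub>E A"
    using assms permutes_in_image[OF assms(1)] permutes_not_in[OF assms(1)]
    by (auto simp: samples_def PiE_iff extensional_def)
  moreover have "inj_on (S \<circ> \<sigma>) {1..M}" if "inj_on S {1..M}"
    using that assms(1) by (metis comp_inj_on permutes_image permutes_inj_on)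
  ultimately show ?thesis using assms(2) by (auto simp: samples_def)
qed

lemma draw_pmf_exchangeable:
  assumes "finite A" "A \<noteq> {}" "M \<in> sizes s A" "\<sigma> permutes {1..M}"
  shows "map_pmf (\<lambda>S. S \<circ> \<sigma>) (draw_pmf s A M) = draw_pmf s A M"
proof -
  have inv: "inv \<sigma> permutes {1..M}" using assms(4) by (rule permutes_inv)
  have "bij_betw (\<lambda>S. S \<circ> \<sigma>) (samples s A M) (samples s A M)"
  proof (rule bij_betwI[where g = "\<lambda>S. S \<circ> inv \<sigma>"])
    show "(S \<circ> \<sigma>) \<circ> inv \<sigma> = S" "(S \<circ> inv \<sigma>) \<circ> \<sigma> = S" for S :: "nat \<Rightarrow> nat set"
      using assms(4) by (simp_all add: comp_assoc permutes_inv_o)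
  qed (use samples_comp_permutes assms(4) inv in blast)+
  then show ?thesis
    unfolding draw_pmf_uniform[OF assms(1,2)]
    by (rule map_pmf_of_set_bij_betw) (use assms samples_nonempty finite_samples in auto)
qed

lemma sizes_downward: "M \<in> sizes s A \<Longrightarrow> 1 \<le> m \<Longrightarrow> m \<le> M \<Longrightarrow> m \<in> sizes s A"
  by (cases s) (auto simp: sizes_def)

lemma simple_random_sample_component:
  assumes "simple_random_sample \<Omega> s A L X" "l \<in> L"
  shows "(\<lambda>\<omega>. X \<omega> l) \<in> \<Omega> \<rightarrow>\<^sub>M count_space A"
  using assms unfolding simple_random_sample_def draw_space_def
  by (auto intro: measurable_component_singleton[THEN measurable_compose[rotated]])

lemma simple_random_sample_prefix_measurable:
  assumes X: "simple_random_sample \<Omega> s A L X" and A: "finite A" and L: "{1..M} \<subseteq> L"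
  shows "(\<lambda>\<omega>. restrict (X \<omega>) {1..M}) \<in> \<Omega> \<rightarrow>\<^sub>M count_space UNIV"
proof -
  have comp: "(\<lambda>\<omega>. X \<omega> l) \<in> \<Omega> \<rightarrow>\<^sub>M count_space A" if "l \<in> {1..M}" for l
    using simple_random_sample_component[OF X] L that by auto
  have "(\<lambda>\<omega>. restrict (X \<omega>) {1..M}) \<in> \<Omega> \<rightarrow>\<^sub>M count_space ({1..M} \<rightarrow>\<^sub>E A)"
  proof (subst measurable_count_space_eq2, intro finite_PiE A, simp, intro conjI ballI)
    show "(\<lambda>\<omega>. restrict (X \<omega>) {1..M}) \<in> space \<Omega> \<rightarrow> {1..M} \<rightarrow>\<^sub>E A"
      using measurable_space[OF comp] by auto
    fix S assume S: "S \<in> {1..M} \<rightarrow>\<^sub>E A"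
    have eq: "(\<lambda>\<omega>. restrict (X \<omega>) {1..M}) -` {S} \<inter> space \<Omega>
      = {\<omega> \<in> space \<Omega>. \<forall>l\<in>{1..M}. X \<omega> l = S l}"
      using S by (auto simp: PiE_iff extensional_def fun_eq_iff restrict_def)
    have "{\<omega> \<in> space \<Omega>. X \<omega> l = S l} \<in> sets \<Omega>" if "l \<in> {1..M}" for l
    proof -
      have "(\<lambda>\<omega>. X \<omega> l) -` {S l} \<inter> space \<Omega> \<in> sets \<Omega>"
        using measurable_sets[OF comp[OF that], of "{S l}"] S that by (auto simp: PiE_iff)
      moreover have "(\<lambda>\<omega>. X \<omega> l) -` {S l} \<inter> space \<Omega> = {\<omega> \<in> space \<Omega>. X \<omega> l = S l}" by auto
      ultimately show ?thesis by simp
    qed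
    then show "(\<lambda>\<omega>. restrict (X \<omega>) {1..M}) -` {S} \<inter> space \<Omega> \<in> sets \<Omega>"
      unfolding eq by (intro sets.sets_Collect_finite_All) auto
  qed
  then show ?thesis
    by (rule measurable_compose) simp
qed

lemma simple_random_sample_expectation:
  fixes h :: "(nat \<Rightarrow> nat set) \<Rightarrow> real"
  assumes X: "simple_random_sample \<Omega> s A L X" and A: "finite A" and L: "{1..M} \<subseteq> L" "M \<in> L"
    and h: "\<And>S. h (restrict S {1..M}) = h S"
  shows "(\<integral>\<omega>. h (X \<omega>) \<partial>\<Omega>) = measure_pmf.expectation (draw_pmf s A M) h"
proof -
  have "distr \<Omega> (count_space UNIV) (\<lambda>\<omega>. restrict (X \<omega>) {1..M}) = measure_pmf (draw_pmf s A M)"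
    using X L unfolding simple_random_sample_def by auto
  then have "measure_pmf.expectation (draw_pmf s A M) h
    = (\<integral>\<omega>. h (restrict (X \<omega>) {1..M}) \<partial>\<Omega>)"
    by (metis integral_distr[OF simple_random_sample_prefix_measurable[OF X A L(1)]]
        borel_measurable_count_space)
  then show ?thesis by (simp only: h)
qed

text \<open>
  The laws of samples of different sizes are consistent because all of them are laws of prefixes of
  one sequence \<open>X\<close>; without replacement this saves counting injective extensions.
\<close>

lemma simple_random_sample_pair_expectation:
  fixes g :: "nat set \<Rightarrow> nat set \<Rightarrow> real"
  assumes X: "simple_random_sample \<Omega> s A (sizes s A) X" and A: "finite A"
    and M: "M \<in> sizes s A" "2 \<le> M"
  shows "measure_pmf.expectation (draw_pmf s A M) (\<lambda>S. g (S 1) (S 2))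
    = measure_pmf.expectation (draw_pmf s A 2) (\<lambda>S. g (S 1) (S 2))"
proof -
  have sub: "{1..M} \<subseteq> sizes s A" "{1..2} \<subseteq> sizes s A" "2 \<in> sizes s A"
    using M sizes_downward by auto
  have "(\<integral>\<omega>. g (X \<omega> 1) (X \<omega> 2) \<partial>\<Omega>)
      = measure_pmf.expectation (draw_pmf s A M) (\<lambda>S. g (S 1) (S 2))"
    by (rule simple_random_sample_expectation[OF X A sub(1) M(1)]) (use M in auto)
  moreover have "(\<integral>\<omega>. g (X \<omega> 1) (X \<omega> 2) \<partial>\<Omega>)
      = measure_pmf.expectation (draw_pmf s A 2) (\<lambda>S. g (S 1) (S 2))"
    by (rule simple_random_sample_expectation[OF X A sub(2,3)]) auto
  ultimately show ?thesis by simp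
qed

section \<open>A maximal inequality for U-statistics\<close>

text \<open>
  Division by zero gives the value \<open>0\<close> when \<open>M < 2\<close>, which is the right convention here: a single
  draw has no off-diagonal terms to be controlled.
\<close>

definition u_statistic :: "('a \<Rightarrow> 'a \<Rightarrow> real) \<Rightarrow> nat \<Rightarrow> (nat \<Rightarrow> 'a) \<Rightarrow> real" where
  "u_statistic g M S =
     (\<Sum>(i, j)\<in>{(i, j). i \<in> {1..M} \<and> j \<in> {1..M} \<and> i \<noteq> j}. g (S i) (S j))
       / (real M * (real M - 1))"

lemma finite_ordered_pairs: "finite {(i, j). i \<in> {1..M::nat} \<and> j \<in> {1..M} \<and> i \<noteq> j}"
  by (rule finite_subset[of _ "{1..M} \<times> {1..M}"]) auto

lemma sum_ordered_pairs:
  fixes F :: "nat \<Rightarrow> nat \<Rightarrow> real"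
  shows "(\<Sum>(i, j)\<in>{(i, j). i \<in> {1..M::nat} \<and> j \<in> {1..M} \<and> i \<noteq> j}. F i j)
    = (\<Sum>i=1..M. \<Sum>j=1..M. F i j) - (\<Sum>i=1..M. F i i)"
proof -
  have "(\<Sum>i=1..M. \<Sum>j=1..M. F i j) = (\<Sum>(i, j)\<in>{1..M} \<times> {1..M}. F i j)"
    by (rule sum.cartesian_product)
  also have "{1..M} \<times> {1..M} = {(i, j). i \<in> {1..M::nat} \<and> j \<in> {1..M} \<and> i \<noteq> j} \<union> (\<lambda>i. (i, i)) ` {1..M}"
    by auto
  also have "(\<Sum>(i, j)\<in>\<dots>. F i j)
    = (\<Sum>(i, j)\<in>{(i, j). i \<in> {1..M::nat} \<and> j \<in> {1..M} \<and> i \<noteq> j}. F i j)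
      + (\<Sum>(i, j)\<in>(\<lambda>i. (i, i)) ` {1..M}. F i j)"
    by (rule sum.union_disjoint[OF finite_ordered_pairs]) auto
  also have "(\<Sum>(i, j)\<in>(\<lambda>i. (i, i)) ` {1..M}. F i j) = (\<Sum>i=1..M. F i i)"
    by (subst sum.reindex) (auto simp: inj_on_def)
  finally show ?thesis by simp
qed

lemma card_ordered_pairs:
  "real (card {(i, j). i \<in> {1..M::nat} \<and> j \<in> {1..M} \<and> i \<noteq> j}) = real M * (real M - 1)"
  using sum_ordered_pairs[of "\<lambda>_ _. 1" M] by (simp add: algebra_simps)

lemma u_statistic_permute:
  assumes "\<sigma> permutes {1..M}"
  shows "u_statistic g M (S \<circ> \<sigma>) = u_statistic g M S"
proof -
  let ?Q = "{(i, j). i \<in> {1..M} \<and> j \<in> {1..M} \<and> i \<noteq> j}"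
  have maps: "map_prod \<tau> \<tau> \<in> ?Q \<rightarrow> ?Q" if "\<tau> permutes {1..M}" for \<tau>
  proof
    fix z assume "z \<in> ?Q"
    then obtain i j where z: "z = (i, j)" "i \<in> {1..M}" "j \<in> {1..M}" "i \<noteq> j" by blast
    then show "map_prod \<tau> \<tau> z \<in> ?Q"
      by (simp add: permutes_in_image[OF that] inj_eq[OF permutes_inj[OF that]]
          del: atLeastAtMost_iff One_nat_def)
  qed
  have "bij_betw (map_prod \<sigma> \<sigma>) ?Q ?Q"
  proof (rule bij_betwI[where g = "map_prod (inv \<sigma>) (inv \<sigma>)"])
    show "map_prod (inv \<sigma>) (inv \<sigma>) (map_prod \<sigma> \<sigma> z) = z"
      "map_prod \<sigma> \<sigma> (map_prod (inv \<sigma>) (inv \<sigma>) z) = z" for z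
      by (cases z, simp add: permutes_inverses[OF assms])+
  qed (fact maps[OF assms] maps[OF permutes_inv[OF assms]])+
  from sum.reindex_bij_betw[OF this, of "\<lambda>(i, j). g (S i) (S j)"]
  show ?thesis
    unfolding u_statistic_def by (simp add: case_prod_unfold)
qed

lemma u_statistic_eq_0: "M < 2 \<Longrightarrow> u_statistic g M S = 0"
  unfolding u_statistic_def by (cases "M = 0") (auto simp: numeral_2_eq_2 less_Suc_eq)

lemma permutes_two_points:
  fixes M :: nat
  assumes "i \<in> {1..M}" "j \<in> {1..M}" "i \<noteq> j"
  obtains \<sigma> where "\<sigma> permutes {1..M}" "\<sigma> 1 = i" "\<sigma> 2 = j"
proof -
  let ?t = "Transposition.transpose 1 i" and ?x = "Transposition.transpose 1 i j"
  let ?\<sigma> = "?t \<circ> Transposition.transpose 2 ?x"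
  have M: "1 \<in> {1..M}" "2 \<in> {1..M}" using assms by auto
  have x: "?x \<in> {1..M}" "?x \<noteq> 1" using assms M by (auto simp: Transposition.transpose_def)
  have "?\<sigma> permutes {1..M}"
    using assms M x by (intro permutes_compose permutes_swap_id) auto
  moreover have "?\<sigma> 1 = i" using x by (auto simp: Transposition.transpose_def)
  moreover have "?\<sigma> 2 = j" by simp
  ultimately show ?thesis using that by blast
qed

text \<open>
  All pairs of distinct draws among the first \<open>M\<close> have the same law, even after restriction to an
  event that does not notice permutations of these draws.
\<close>

lemma expectation_u_statistic:
  fixes q :: "(nat \<Rightarrow> 'a) pmf" and g :: "'a \<Rightarrow> 'a \<Rightarrow> real"
  assumes fin: "finite (set_pmf q)"
    and exch: "\<And>\<sigma>. \<sigma> permutes {1..M} \<Longrightarrow> map_pmf (\<lambda>S. S \<circ> \<sigma>) q = q"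
    and F: "\<And>\<sigma> S. \<sigma> permutes {1..M} \<Longrightarrow> S \<circ> \<sigma> \<in> F \<longleftrightarrow> S \<in> F"
    and M: "2 \<le> M"
  shows "measure_pmf.expectation q (\<lambda>S. u_statistic g M S * indicator F S)
    = measure_pmf.expectation q (\<lambda>S. g (S 1) (S 2) * indicator F S)"
proof -
  let ?Q = "{(i, j). i \<in> {1..M} \<and> j \<in> {1..M} \<and> i \<noteq> j}"
  let ?E = "measure_pmf.expectation q (\<lambda>S. g (S 1) (S 2) * indicator F S)"
  have pair: "measure_pmf.expectation q (\<lambda>S. g (S i) (S j) * indicator F S) = ?E"
    if "(i, j) \<in> ?Q" for i j
  proof -
    obtain \<sigma> where \<sigma>: "\<sigma> permutes {1..M}" "\<sigma> 1 = i" "\<sigma> 2 = j"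
      using permutes_two_points \<open>(i, j) \<in> ?Q\<close> by blast
    have "?E = measure_pmf.expectation (map_pmf (\<lambda>S. S \<circ> \<sigma>) q) (\<lambda>S. g (S 1) (S 2) * indicator F S)"
      by (simp only: exch[OF \<sigma>(1)])
    also have "\<dots> = measure_pmf.expectation q (\<lambda>S. g (S i) (S j) * indicator F S)"
      by (simp add: \<sigma> F[OF \<sigma>(1)] indicator_def del: One_nat_def)
    finally show ?thesis by simp
  qed
  have "measure_pmf.expectation q (\<lambda>S. u_statistic g M S * indicator F S)
    = measure_pmf.expectation q
        (\<lambda>S. (\<Sum>(i, j)\<in>?Q. g (S i) (S j) * indicator F S) / (real M * (real M - 1)))"
    by (simp add: u_statistic_def sum_distrib_right case_prod_unfold)
  also have "\<dots> = measure_pmf.expectation q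
        (\<lambda>S. \<Sum>(i, j)\<in>?Q. g (S i) (S j) * indicator F S) / (real M * (real M - 1))"
    by simp
  also have "measure_pmf.expectation q (\<lambda>S. \<Sum>(i, j)\<in>?Q. g (S i) (S j) * indicator F S)
    = (\<Sum>(i, j)\<in>?Q. measure_pmf.expectation q (\<lambda>S. g (S i) (S j) * indicator F S))"
    unfolding case_prod_unfold
    by (rule Bochner_Integration.integral_sum) (rule integrable_measure_pmf_finite[OF fin])
  also have "\<dots> = (\<Sum>(i, j)\<in>?Q. ?E)"
    using pair by (intro sum.cong) auto
  also have "\<dots> = real M * (real M - 1) * ?E"
    by (simp add: case_prod_unfold flip: card_ordered_pairs)
  finally show ?thesis using M by simp
qed

text \<open>
  U-statistics of an exchangeable sample form a reversed martingale.  This is Doob's inequality for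
  it, proved by splitting according to the last \<open>M\<close> at which \<open>\<epsilon>\<close> is exceeded.  Whether a given \<open>M\<close>
  is that last one depends on the first \<open>M\<close> draws only through symmetric functions, so on this event
  the U-statistic and the kernel of the first two draws have the same expectation.
\<close>

lemma u_statistic_maximal_inequality:
  fixes q :: "(nat \<Rightarrow> 'a) pmf" and g :: "'a \<Rightarrow> 'a \<Rightarrow> real"
  assumes fin: "finite (set_pmf q)"
    and exch: "\<And>\<sigma>. \<sigma> permutes {1..m} \<Longrightarrow> map_pmf (\<lambda>S. S \<circ> \<sigma>) q = q"
    and g: "\<And>a b. 0 \<le> g a b" and \<epsilon>: "0 < \<epsilon>"
  shows "measure_pmf.prob q {S. \<exists>M\<in>{2..m}. \<epsilon> < u_statistic g M S}
    \<le> measure_pmf.expectation q (\<lambda>S. g (S 1) (S 2)) / \<epsilon>"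
proof -
  have int: "integrable (measure_pmf q) h" for h :: "(nat \<Rightarrow> 'a) \<Rightarrow> real"
    by (rule integrable_measure_pmf_finite[OF fin])
  (* F M: the last exceedance happens at M *)
  define F where "F M = {S. \<epsilon> < u_statistic g M S \<and> (\<forall>M'\<in>{M<..m}. u_statistic g M' S \<le> \<epsilon>)}" for M
  have disj: "disjoint_family_on F {2..m}"
  proof -
    have "F M \<inter> F M' = {}" if "M < M'" "M' \<le> m" for M M'
      using that by (force simp: F_def)
    then show ?thesis
      unfolding disjoint_family_on_def
      by (metis Int_commute atLeastAtMost_iff linorder_neqE_nat)
  qed
  have un: "{S. \<exists>M\<in>{2..m}. \<epsilon> < u_statistic g M S} = (\<Union>M\<in>{2..m}. F M)"
  proof (intro equalityI subsetI)
    fix S assume "S \<in> {S. \<exists>M\<in>{2..m}. \<epsilon> < u_statistic g M S}"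
    then have ne: "{M\<in>{2..m}. \<epsilon> < u_statistic g M S} \<noteq> {}" by auto
    let ?M = "Max {M\<in>{2..m}. \<epsilon> < u_statistic g M S}"
    have fin': "finite {M\<in>{2..m}. \<epsilon> < u_statistic g M S}" by auto
    have M: "?M \<in> {2..m}" "\<epsilon> < u_statistic g ?M S" using Max_in[OF fin' ne] by auto
    have "u_statistic g M' S \<le> \<epsilon>" if "M' \<in> {?M<..m}" for M'
      using Max_ge[OF fin', of M'] that M by (force simp: not_less[symmetric])
    then show "S \<in> (\<Union>M\<in>{2..m}. F M)" using M unfolding F_def by blast
  qed (auto simp: F_def)
  have step: "\<epsilon> * measure_pmf.prob q (F M)
      \<le> measure_pmf.expectation q (\<lambda>S. g (S 1) (S 2) * indicator (F M) S)" if M: "M \<in> {2..m}" for M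
  proof -
    have perm: "\<sigma> permutes {1..M'}" if "\<sigma> permutes {1..M}" "M \<le> M'" for \<sigma> M'
      using that by (elim permutes_subset) auto
    have "\<epsilon> * measure_pmf.prob q (F M) = measure_pmf.expectation q (\<lambda>S. \<epsilon> * indicator (F M) S)"
      by simp
    also have "\<dots> \<le> measure_pmf.expectation q (\<lambda>S. u_statistic g M S * indicator (F M) S)"
      by (intro integral_mono int) (auto simp: F_def indicator_def)
    also have "\<dots> = measure_pmf.expectation q (\<lambda>S. g (S 1) (S 2) * indicator (F M) S)"
    proof (rule expectation_u_statistic[OF fin])
      show "map_pmf (\<lambda>S. S \<circ> \<sigma>) q = q" if "\<sigma> permutes {1..M}" for \<sigma>
        using exch perm[OF that] M by auto
      show "S \<circ> \<sigma> \<in> F M \<longleftrightarrow> S \<in> F M" if "\<sigma> permutes {1..M}" for \<sigma> S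
        using perm[OF that] by (auto simp: F_def u_statistic_permute)
    qed (use M in auto)
    finally show ?thesis .
  qed
  have "measure_pmf.prob q (\<Union>M\<in>{2..m}. F M) = (\<Sum>M=2..m. measure_pmf.prob q (F M))"
    by (rule measure_pmf.finite_measure_finite_Union) (use disj in auto)
  then have "\<epsilon> * measure_pmf.prob q (\<Union>M\<in>{2..m}. F M)
    \<le> (\<Sum>M=2..m. measure_pmf.expectation q (\<lambda>S. g (S 1) (S 2) * indicator (F M) S))"
    using step by (auto simp: sum_distrib_left intro: sum_mono)
  also have "\<dots> = measure_pmf.expectation q (\<lambda>S. \<Sum>M=2..m. g (S 1) (S 2) * indicator (F M) S)"
    by (rule Bochner_Integration.integral_sum[symmetric]) (rule int)
  also have "\<dots> \<le> measure_pmf.expectation q (\<lambda>S. g (S 1) (S 2))"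
  proof (intro integral_mono int)
    fix S
    have "(\<Sum>M=2..m. indicator (F M) S :: real) = indicator (\<Union>M\<in>{2..m}. F M) S"
      using disj by (intro indicator_UN_disjoint[symmetric]) auto
    then show "(\<Sum>M=2..m. g (S 1) (S 2) * indicator (F M) S) \<le> g (S 1) (S 2)"
      using g by (simp add: indicator_def flip: sum_distrib_left)
  qed
  finally show ?thesis
    unfolding un using \<epsilon> by (simp add: field_simps)
qed

section \<open>Risks as averages of cross risks\<close>

text \<open>
  Bagging averages residuals, so the squared error of a bagged predictor is a quadratic form in
  residuals and its risk an average of the entries of their Gram matrix in the space of
  square-integrable functions.
\<close>

definition residual :: "predictor \<Rightarrow> (nat \<Rightarrow> obs) \<Rightarrow> nat set \<Rightarrow> obs \<Rightarrow> real" where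
  "residual f d B z = snd z - f (fst z) (subdata d B)"

definition cross_risk ::
    "obs measure \<Rightarrow> predictor \<Rightarrow> (nat \<Rightarrow> obs) \<Rightarrow> nat set \<Rightarrow> nat set \<Rightarrow> real" where
  "cross_risk P f d B C = (\<integral>z. residual f d B z * residual f d C z \<partial>P)"

definition cross_deviation ::
    "obs measure \<Rightarrow> predictor \<Rightarrow> (nat \<Rightarrow> obs) \<Rightarrow> real \<Rightarrow> nat set \<Rightarrow> nat set \<Rightarrow> real" where
  "cross_deviation P f d c B C = \<bar>cross_risk P f d B C - c\<bar>"

lemma bagged_residual:
  assumes "1 \<le> M"
  shows "snd z - bagged f d M S (fst z) = (\<Sum>i=1..M. residual f d (S i) z) / real M"
  using assms by (simp add: bagged_def residual_def sum_subtractf field_simps)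

lemma subsample_risk_residual:
  assumes "1 \<le> M"
  shows "subsample_risk P f d M S
    = (\<integral>\<^sup>+z. ennreal (((\<Sum>i=1..M. residual f d (S i) z) / real M)\<^sup>2) \<partial>P)"
  unfolding subsample_risk_def by (simp only: bagged_residual[OF assms] case_prod_unfold)

lemma subsample_risk_singleton:
  "subsample_risk P f d 1 (\<lambda>_. B) = (\<integral>\<^sup>+z. ennreal ((residual f d B z)\<^sup>2) \<partial>P)"
  by (simp add: subsample_risk_residual)

lemma integrable_residual_mult:
  assumes res: "residual f d B \<in> borel_measurable P" "residual f d C \<in> borel_measurable P"
    and fin: "subsample_risk P f d 1 (\<lambda>_. B) < \<infinity>" "subsample_risk P f d 1 (\<lambda>_. C) < \<infinity>"
  shows "integrable P (\<lambda>z. residual f d B z * residual f d C z)"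
proof -
  have sq: "integrable P (\<lambda>z. (residual f d B z)\<^sup>2)" "integrable P (\<lambda>z. (residual f d C z)\<^sup>2)"
    using res fin unfolding subsample_risk_singleton
    by (auto intro!: integrableI_bounded borel_measurable_power)
  have bound: "\<bar>a * b\<bar> \<le> a\<^sup>2 + b\<^sup>2" for a b :: real
    using sum_squares_bound[of "\<bar>a\<bar>" "\<bar>b\<bar>"] mult_nonneg_nonneg[of "\<bar>a\<bar>" "\<bar>b\<bar>"]
    by (simp only: abs_mult power2_abs) linarith
  show ?thesis
    using res bound
    by (intro Bochner_Integration.integrable_bound[OF Bochner_Integration.integrable_add[OF sq]])
      (auto intro: borel_measurable_times)
qed

lemma integral_mean_residual_square:
  assumes res: "\<And>B. B \<in> A \<Longrightarrow> residual f d B \<in> borel_measurable P"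
    and fin: "\<And>B. B \<in> A \<Longrightarrow> subsample_risk P f d 1 (\<lambda>_. B) < \<infinity>"
    and S: "\<And>i. i \<in> {1..M} \<Longrightarrow> S i \<in> A"
  shows "has_bochner_integral P (\<lambda>z. ((\<Sum>i=1..M. residual f d (S i) z) / real M)\<^sup>2)
    ((\<Sum>i=1..M. \<Sum>j=1..M. cross_risk P f d (S i) (S j)) / (real M)\<^sup>2)"
proof -
  have "has_bochner_integral P
      (\<lambda>z. (\<Sum>i=1..M. \<Sum>j=1..M. residual f d (S i) z * residual f d (S j) z) / (real M)\<^sup>2)
      ((\<Sum>i=1..M. \<Sum>j=1..M. cross_risk P f d (S i) (S j)) / (real M)\<^sup>2)"
    unfolding cross_risk_def
    by (intro has_bochner_integral_divide has_bochner_integral_sum has_bochner_integral_integrable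
        integrable_residual_mult res fin S impI)
  then show ?thesis
    by (simp add: power_divide power2_eq_square sum_product)
qed

text \<open>
  Finiteness of the single risks is what allows passing from integrals of nonnegative functions,
  possibly infinite, to the bilinear Bochner integral.
\<close>

lemma subsample_risk_cross_risk:
  assumes res: "\<And>B. B \<in> A \<Longrightarrow> residual f d B \<in> borel_measurable P"
    and fin: "\<And>B. B \<in> A \<Longrightarrow> subsample_risk P f d 1 (\<lambda>_. B) < \<infinity>"
    and S: "\<And>i. i \<in> {1..M} \<Longrightarrow> S i \<in> A" and M: "1 \<le> M"
  shows "subsample_risk P f d M S
      = ennreal ((\<Sum>i=1..M. \<Sum>j=1..M. cross_risk P f d (S i) (S j)) / (real M)\<^sup>2)"
    and "0 \<le> (\<Sum>i=1..M. \<Sum>j=1..M. cross_risk P f d (S i) (S j)) / (real M)\<^sup>2"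
proof -
  note I = integral_mean_residual_square[where A = A and f = f and d = d and P = P and S = S and M = M,
      OF res fin S]
  show "subsample_risk P f d M S
      = ennreal ((\<Sum>i=1..M. \<Sum>j=1..M. cross_risk P f d (S i) (S j)) / (real M)\<^sup>2)"
    unfolding subsample_risk_residual[OF M] using I
    by (subst nn_integral_eq_integral)
      (auto simp: has_bochner_integral_iff simp del: One_nat_def)
  have "0 \<le> (\<integral>z. ((\<Sum>i=1..M. residual f d (S i) z) / real M)\<^sup>2 \<partial>P)"
    by (rule Bochner_Integration.integral_nonneg) simp
  with I show "0 \<le> (\<Sum>i=1..M. \<Sum>j=1..M. cross_risk P f d (S i) (S j)) / (real M)\<^sup>2"
    by (simp only: has_bochner_integral_iff)
qed

lemma deviation_ennreal: "0 \<le> r \<Longrightarrow> deviation (ennreal r) c = ereal \<bar>r - c\<bar>"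
  by (simp add: deviation_def)

lemma deviation_le_imp_finite:
  assumes "deviation r c \<le> ereal \<delta>"
  shows "r < \<infinity>"
proof (rule ccontr)
  assume "\<not> r < \<infinity>"
  then have "r = \<infinity>" by (simp add: less_top[symmetric] top_unique)
  then show False using assms by (simp add: deviation_def)
qed

lemma cross_risk_diagonal:
  assumes res: "\<And>B. B \<in> A \<Longrightarrow> residual f d B \<in> borel_measurable P"
    and risk1: "\<And>B. B \<in> A \<Longrightarrow> deviation (subsample_risk P f d 1 (\<lambda>_. B)) b1 \<le> ereal \<delta>"
    and B: "B \<in> A"
  shows "\<bar>cross_risk P f d B B - b1\<bar> \<le> \<delta>"
proof -
  have fin: "subsample_risk P f d 1 (\<lambda>_. B) < \<infinity>" if "B \<in> A" for B
    using risk1[OF that] by (rule deviation_le_imp_finite)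
  have "subsample_risk P f d 1 (\<lambda>_. B) = ennreal (cross_risk P f d B B)" "0 \<le> cross_risk P f d B B"
    using subsample_risk_cross_risk[where A = A and f = f and d = d and P = P and M = 1
        and S = "\<lambda>_. B", OF res fin] B by auto
  with risk1[OF B] show ?thesis by (simp add: deviation_ennreal)
qed

text \<open>
  Replace diagonal cross risks by \<open>b1\<close> and off-diagonal ones by \<open>2 * b2 - b1\<close>.  Diagonal terms
  contribute an error of at most \<open>\<delta>\<close>.  The off-diagonal ones make up a fraction
  \<open>(M - 1) / M\<close> of all pairs, which is where the \<open>1 / M\<close> in the limiting profile comes from.
\<close>

lemma subsample_risk_deviation_le:
  fixes b1 b2 \<delta> :: real
  assumes res: "\<And>B. B \<in> A \<Longrightarrow> residual f d B \<in> borel_measurable P"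
    and risk1: "\<And>B. B \<in> A \<Longrightarrow> deviation (subsample_risk P f d 1 (\<lambda>_. B)) b1 \<le> ereal \<delta>"
    and S: "\<And>i. i \<in> {1..M} \<Longrightarrow> S i \<in> A" and M: "1 \<le> M"
  shows "deviation (subsample_risk P f d M S) ((2 * b2 - b1) + 2 * (b1 - b2) / real M)
    \<le> ereal (\<delta> + u_statistic (cross_deviation P f d (2 * b2 - b1)) M S)"
proof -
  let ?c = "cross_risk P f d" and ?\<gamma> = "2 * b2 - b1"
  let ?Q = "{(i, j). i \<in> {1..M} \<and> j \<in> {1..M} \<and> i \<noteq> j}"
  have fin: "subsample_risk P f d 1 (\<lambda>_. B) < \<infinity>" if "B \<in> A" for B
    using risk1[OF that] by (rule deviation_le_imp_finite)
  have diag: "\<bar>?c B B - b1\<bar> \<le> \<delta>" if "B \<in> A" for B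
    by (rule cross_risk_diagonal[OF res risk1 that])
  have \<delta>: "0 \<le> \<delta>" using diag S M by fastforce
  define R where "R = (\<Sum>i=1..M. \<Sum>j=1..M. ?c (S i) (S j)) / (real M)\<^sup>2"
  have R: "subsample_risk P f d M S = ennreal R" "0 \<le> R"
    unfolding R_def
    by (rule subsample_risk_cross_risk[where A = A]; use res fin S M in blast)+
  let ?D = "\<Sum>i=1..M. ?c (S i) (S i) - b1" and ?O = "\<Sum>(i, j)\<in>?Q. ?c (S i) (S j) - ?\<gamma>"
  let ?G = "\<Sum>(i, j)\<in>?Q. cross_deviation P f d (2 * b2 - b1) (S i) (S j)"
  have "?O = (\<Sum>(i, j)\<in>?Q. ?c (S i) (S j)) - real M * (real M - 1) * ?\<gamma>"
    by (simp add: case_prod_unfold sum_subtractf flip: card_ordered_pairs)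
  moreover have "?D = (\<Sum>i=1..M. ?c (S i) (S i)) - real M * b1"
    by (simp add: sum_subtractf)
  ultimately have "?D + ?O
      = (\<Sum>i=1..M. \<Sum>j=1..M. ?c (S i) (S j)) - (real M * b1 + real M * (real M - 1) * ?\<gamma>)"
    using sum_ordered_pairs[of "\<lambda>i j. ?c (S i) (S j)" M] by linarith
  moreover have "(real M * b1 + real M * (real M - 1) * ?\<gamma>) / (real M)\<^sup>2
      = ?\<gamma> + 2 * (b1 - b2) / real M"
    using M by (simp add: field_simps power2_eq_square)
  ultimately have eq: "R - (?\<gamma> + 2 * (b1 - b2) / real M) = (?D + ?O) / (real M)\<^sup>2"
    unfolding R_def by (simp add: diff_divide_distrib)
  have "\<bar>?D\<bar> \<le> (\<Sum>i=1..M. \<delta>)"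
    by (rule order_trans[OF sum_abs sum_mono]) (use diag S in auto)
  then have D: "\<bar>?D\<bar> \<le> real M * \<delta>" by simp
  have O: "\<bar>?O\<bar> \<le> ?G"
    unfolding cross_deviation_def case_prod_unfold by (rule sum_abs)
  have "\<bar>(?D + ?O) / (real M)\<^sup>2\<bar> \<le> (real M * \<delta> + ?G) / (real M)\<^sup>2"
    using D O by (auto simp: abs_divide intro!: divide_right_mono)
  also have "\<dots> = \<delta> / real M + ?G / (real M)\<^sup>2"
    using M by (simp add: add_divide_distrib power2_eq_square)
  also have "\<dots> \<le> \<delta> + u_statistic (cross_deviation P f d (2 * b2 - b1)) M S"
  proof (rule add_mono)
    show "\<delta> / real M \<le> \<delta>" using M \<delta> by (simp add: field_simps mult_le_cancel_left1)
    show "?G / (real M)\<^sup>2 \<le> u_statistic (cross_deviation P f d (2 * b2 - b1)) M S"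
    proof (cases "M = 1")
      case True
      then have "?Q = {}" by auto
      then show ?thesis by (simp only: u_statistic_def sum.empty)
    next
      case False
      then have "2 \<le> M" using M by simp
      have G: "0 \<le> ?G" by (intro sum_nonneg) (auto simp: cross_deviation_def)
      show ?thesis
        unfolding u_statistic_def using \<open>2 \<le> M\<close>
        by (intro divide_left_mono G) (auto simp: power2_eq_square)
    qed
  qed
  finally show ?thesis
    unfolding R(1) deviation_ennreal[OF R(2)] eq by simp
qed

text \<open>
  There are only finitely many samples of size \<open>M\<close>, so the integral over the draw is a finite sum
  and can be moved outside the integral over the test point.
\<close>

lemma data_risk_average:
  assumes A: "finite A" "A \<noteq> {}" "M \<in> sizes s A"
    and res: "\<And>B. B \<in> A \<Longrightarrow> residual f d B \<in> borel_measurable P"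
  shows "data_risk P f d s A M = (\<integral>\<^sup>+S. subsample_risk P f d M S \<partial>measure_pmf (draw_pmf s A M))"
proof -
  let ?q = "draw_pmf s A M"
  have M: "1 \<le> M" using A(3) by (cases s) (auto simp: sizes_def)
  have fin: "finite (set_pmf ?q)" using A finite_samples by (simp add: set_draw_pmf)
  have meas: "(\<lambda>z. ennreal (((\<Sum>i=1..M. residual f d (S i) z) / real M)\<^sup>2)) \<in> borel_measurable P"
    if "S \<in> set_pmf ?q" for S
  proof -
    have "S i \<in> A" if "i \<in> {1..M}" for i
      using that \<open>S \<in> set_pmf ?q\<close> A by (auto simp: set_draw_pmf samples_def PiE_iff)
    note [measurable] = res[OF this]
    show ?thesis by measurable
  qed
  have "data_risk P f d s A M
    = (\<integral>\<^sup>+z. (\<integral>\<^sup>+S. ennreal (((\<Sum>i=1..M. residual f d (S i) z) / real M)\<^sup>2) \<partial>measure_pmf ?q) \<partial>P)"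
    unfolding data_risk_def by (simp only: bagged_residual[OF M] case_prod_unfold)
  also have "\<dots> = (\<integral>\<^sup>+z. (\<Sum>S\<in>set_pmf ?q.
      ennreal (((\<Sum>i=1..M. residual f d (S i) z) / real M)\<^sup>2) * pmf ?q S) \<partial>P)"
    by (simp add: nn_integral_measure_pmf_finite[OF fin])
  also have "\<dots> = (\<Sum>S\<in>set_pmf ?q. subsample_risk P f d M S * pmf ?q S)"
    unfolding subsample_risk_residual[OF M] using meas
    by (subst nn_integral_sum) (auto simp: nn_integral_multc)
  also have "\<dots> = (\<integral>\<^sup>+S. subsample_risk P f d M S \<partial>measure_pmf ?q)"
    by (simp add: nn_integral_measure_pmf_finite[OF fin])
  finally show ?thesis .
qed

text \<open>
  When two draws are impossible there are no off-diagonal terms at all.  The value \<open>0\<close> then keeps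
  every bound below valid without a case distinction.
\<close>

definition pair_deviation ::
    "obs measure \<Rightarrow> predictor \<Rightarrow> (nat \<Rightarrow> obs) \<Rightarrow> scheme \<Rightarrow> nat set set \<Rightarrow> real \<Rightarrow> real" where
  "pair_deviation P f d s A c =
     (if 2 \<in> sizes s A
      then measure_pmf.expectation (draw_pmf s A 2) (\<lambda>S. cross_deviation P f d c (S 1) (S 2))
      else 0)"

lemma pair_deviation_nonneg: "0 \<le> pair_deviation P f d s A c"
  by (simp add: pair_deviation_def cross_deviation_def)

lemma expectation_u_statistic_cross_risk:
  assumes X: "simple_random_sample \<Omega> s A (sizes s A) X"
    and A: "finite A" "A \<noteq> {}" and M: "M \<in> sizes s A"
  shows "measure_pmf.expectation (draw_pmf s A M)
      (u_statistic (cross_deviation P f d c) M) \<le> pair_deviation P f d s A c"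
proof (cases "2 \<le> M")
  case True
  let ?g = "cross_deviation P f d c"
  have fin: "finite (set_pmf (draw_pmf s A M))" using A M finite_samples by (simp add: set_draw_pmf)
  have "measure_pmf.expectation (draw_pmf s A M) (u_statistic ?g M)
    = measure_pmf.expectation (draw_pmf s A M) (\<lambda>S. ?g (S 1) (S 2))"
    using expectation_u_statistic[OF fin, of M UNIV ?g] draw_pmf_exchangeable[OF A M] True by simp
  also have "\<dots> = measure_pmf.expectation (draw_pmf s A 2) (\<lambda>S. ?g (S 1) (S 2))"
    by (rule simple_random_sample_pair_expectation[OF X A(1) M True])
  finally show ?thesis
    using sizes_downward[OF M, of 2] True by (simp add: pair_deviation_def)
next
  case False
  then have "M = 1" using M by (cases s) (auto simp: sizes_def)
  then show ?thesis using pair_deviation_nonneg by (simp add: u_statistic_def[abs_def])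
qed

lemma data_risk_deviation_le:
  fixes b1 b2 \<delta> :: real
  assumes X: "simple_random_sample \<Omega> s A (sizes s A) X"
    and A: "finite A" "A \<noteq> {}" and M: "M \<in> sizes s A"
    and res: "\<And>B. B \<in> A \<Longrightarrow> residual f d B \<in> borel_measurable P"
    and risk1: "\<And>B. B \<in> A \<Longrightarrow> deviation (subsample_risk P f d 1 (\<lambda>_. B)) b1 \<le> ereal \<delta>"
  shows "deviation (data_risk P f d s A M) ((2 * b2 - b1) + 2 * (b1 - b2) / real M)
    \<le> ereal (\<delta> + pair_deviation P f d s A (2 * b2 - b1))"
proof -
  let ?q = "draw_pmf s A M" and ?g = "cross_deviation P f d (2 * b2 - b1)"
  let ?T = "(2 * b2 - b1) + 2 * (b1 - b2) / real M"
  have M1: "1 \<le> M" using M by (cases s) (auto simp: sizes_def)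
  have fin: "finite (set_pmf ?q)" using A M finite_samples by (simp add: set_draw_pmf)
  have int: "integrable (measure_pmf ?q) h" for h :: "(nat \<Rightarrow> nat set) \<Rightarrow> real"
    by (rule integrable_measure_pmf_finite[OF fin])
  have bound: "deviation (subsample_risk P f d M S) ?T \<le> ereal (\<delta> + u_statistic ?g M S)"
    if "S \<in> set_pmf ?q" for S
  proof (rule subsample_risk_deviation_le[OF res risk1 _ M1])
    show "S i \<in> A" if "i \<in> {1..M}" for i
      using that \<open>S \<in> set_pmf ?q\<close> A M by (auto simp: set_draw_pmf samples_def PiE_iff)
  qed
  define r where "r S = enn2real (subsample_risk P f d M S)" for S
  have r: "subsample_risk P f d M S = ennreal (r S)" if "S \<in> set_pmf ?q" for S
    using deviation_le_imp_finite[OF bound[OF that]] by (simp add: r_def less_top)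
  have r0: "0 \<le> r S" for S by (simp add: r_def)
  have r_bound: "\<bar>r S - ?T\<bar> \<le> \<delta> + u_statistic ?g M S" if "S \<in> set_pmf ?q" for S
    using bound[OF that] by (simp add: r[OF that] deviation_ennreal[OF r0])
  have "data_risk P f d s A M = (\<integral>\<^sup>+S. ennreal (r S) \<partial>measure_pmf ?q)"
    by (subst data_risk_average[OF A M res], assumption, intro nn_integral_cong_AE) (simp add: AE_measure_pmf_iff r)
  also have "\<dots> = ennreal (measure_pmf.expectation ?q r)"
    by (rule nn_integral_eq_integral[OF int]) (simp add: r0)
  finally have "deviation (data_risk P f d s A M) ?T
      = ereal \<bar>measure_pmf.expectation ?q r - ?T\<bar>"
    by (simp add: deviation_ennreal r0)
  also have "\<bar>measure_pmf.expectation ?q r - ?T\<bar> = \<bar>measure_pmf.expectation ?q (\<lambda>S. r S - ?T)\<bar>"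
    by (simp add: Bochner_Integration.integral_diff[OF int int])
  also have "\<dots> \<le> measure_pmf.expectation ?q (\<lambda>S. \<bar>r S - ?T\<bar>)"
    by (rule integral_abs_bound)
  also have "\<dots> \<le> measure_pmf.expectation ?q (\<lambda>S. \<delta> + u_statistic ?g M S)"
    by (intro integral_mono_AE int, unfold AE_measure_pmf_iff) (use r_bound in blast)
  also have "\<dots> = \<delta> + measure_pmf.expectation ?q (u_statistic ?g M)"
    by (simp add: Bochner_Integration.integral_add[OF int int])
  also have "\<dots> \<le> \<delta> + pair_deviation P f d s A (2 * b2 - b1)"
    using expectation_u_statistic_cross_risk[OF X A M] by simp
  finally show ?thesis by simp
qed

lemma u_statistic_restrict:
  assumes "M \<le> m"
  shows "u_statistic g M (restrict S {1..m}) = u_statistic g M S"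
  unfolding u_statistic_def
  by (rule arg_cong2[where f = "(/)"]) (use assms in \<open>auto intro!: sum.cong\<close>)

lemma u_statistic_sample_measurable:
  assumes X: "simple_random_sample \<Omega> s A (sizes s A) X" and A: "finite A" and M: "M \<in> sizes s A"
  shows "(\<lambda>\<omega>. u_statistic g M (X \<omega>)) \<in> borel_measurable \<Omega>"
proof -
  have "{1..M} \<subseteq> sizes s A" using sizes_downward[OF M] by auto
  from measurable_compose[OF simple_random_sample_prefix_measurable[OF X A this]
      borel_measurable_count_space[of "u_statistic g M"]]
  show ?thesis by (simp only: u_statistic_restrict[OF order_refl])
qed

text \<open>
  The maximal inequality for every finite stretch of the sample carries over to the whole sample,
  which is infinite when drawn with replacement, because its bound is the same for all stretches.
\<close>

lemma sample_maximal_inequality: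
  fixes c \<epsilon> :: real
  assumes prob: "prob_space \<Omega>" and X: "simple_random_sample \<Omega> s A (sizes s A) X"
    and A: "finite A" "A \<noteq> {}" and \<epsilon>: "0 < \<epsilon>"
  shows "emeasure \<Omega> {\<omega> \<in> space \<Omega>. \<exists>M\<in>sizes s A. \<epsilon> < u_statistic (cross_deviation P f d c) M (X \<omega>)}
    \<le> ennreal (pair_deviation P f d s A c / \<epsilon>)"
proof -
  interpret prob_space \<Omega> by fact
  let ?g = "cross_deviation P f d c"
  define E where "E m = {\<omega> \<in> space \<Omega>. \<exists>M\<in>sizes s A \<inter> {..m}. \<epsilon> < u_statistic ?g M (X \<omega>)}" for m
  note meas = u_statistic_sample_measurable[OF X A(1)]
  have E_sets: "E m \<in> sets \<Omega>" for m
  proof -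
    have "E m = (\<Union>M\<in>sizes s A \<inter> {..m}. {\<omega> \<in> space \<Omega>. \<epsilon> < u_statistic ?g M (X \<omega>)})"
      by (auto simp: E_def)
    also have "\<dots> \<in> sets \<Omega>"
      using meas[of _ ?g] by (intro sets.finite_UN) (auto intro: borel_measurable_less)
    finally show ?thesis .
  qed
  have bound_in: "emeasure \<Omega> (E m) \<le> ennreal (pair_deviation P f d s A c / \<epsilon>)"
    if m: "m \<in> sizes s A" for m
  proof (cases "2 \<le> m")
    case False
    then have "E m = {}"
      using \<epsilon> by (auto simp: E_def u_statistic_eq_0)
    then show ?thesis by simp
  next
    case True
    let ?q = "draw_pmf s A m"
    have fin: "finite (set_pmf ?q)" using A m finite_samples by (simp add: set_draw_pmf)
    have sub: "{1..m} \<subseteq> sizes s A" using sizes_downward[OF m] by auto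
    have "E m = (\<lambda>\<omega>. restrict (X \<omega>) {1..m}) -` {S. \<exists>M\<in>{2..m}. \<epsilon> < u_statistic ?g M S} \<inter> space \<Omega>"
    proof -
      have "(\<exists>M\<in>sizes s A \<inter> {..m}. \<epsilon> < u_statistic ?g M S)
          \<longleftrightarrow> (\<exists>M\<in>{2..m}. \<epsilon> < u_statistic ?g M S)" for S
      proof
        assume "\<exists>M\<in>sizes s A \<inter> {..m}. \<epsilon> < u_statistic ?g M S"
        then obtain M where M: "M \<le> m" "\<epsilon> < u_statistic ?g M S" by auto
        with u_statistic_eq_0[of M ?g S] \<epsilon> have "2 \<le> M" by (cases "M < 2") auto
        with M show "\<exists>M\<in>{2..m}. \<epsilon> < u_statistic ?g M S" by auto
      next
        assume "\<exists>M\<in>{2..m}. \<epsilon> < u_statistic ?g M S"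
        then show "\<exists>M\<in>sizes s A \<inter> {..m}. \<epsilon> < u_statistic ?g M S"
          using sub by fastforce
      qed
      then show ?thesis
        unfolding E_def by (auto simp: u_statistic_restrict simp del: One_nat_def)
    qed
    also have "emeasure \<Omega> \<dots>
        = emeasure (measure_pmf ?q) {S. \<exists>M\<in>{2..m}. \<epsilon> < u_statistic ?g M S}"
    proof -
      have "distr \<Omega> (count_space UNIV) (\<lambda>\<omega>. restrict (X \<omega>) {1..m}) = measure_pmf ?q"
        using X m by (auto simp: simple_random_sample_def)
      then show ?thesis
        using emeasure_distr[OF simple_random_sample_prefix_measurable[OF X A(1) sub], of _] by simp
    qed
    also have "\<dots> = ennreal (measure_pmf.prob ?q {S. \<exists>M\<in>{2..m}. \<epsilon> < u_statistic ?g M S})"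
      by (rule measure_pmf.emeasure_eq_measure)
    also have "\<dots> \<le> ennreal (measure_pmf.expectation ?q (\<lambda>S. ?g (S 1) (S 2)) / \<epsilon>)"
      using draw_pmf_exchangeable[OF A m] \<epsilon>
      by (intro ennreal_leI u_statistic_maximal_inequality fin) (auto simp: cross_deviation_def)
    also have "\<dots> = ennreal (pair_deviation P f d s A c / \<epsilon>)"
      using simple_random_sample_pair_expectation[OF X A(1) m True] sizes_downward[OF m, of 2] True
      by (simp add: pair_deviation_def)
    finally show ?thesis .
  qed
  have bound: "emeasure \<Omega> (E m) \<le> ennreal (pair_deviation P f d s A c / \<epsilon>)" for m
  proof (cases "sizes s A \<inter> {..m} = {}")
    case True
    then have "E m = {}" unfolding E_def by blast
    then show ?thesis by simp
  next
    case False
    let ?m = "Max (sizes s A \<inter> {..m})"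
    have "?m \<in> sizes s A \<inter> {..m}" using False by (intro Max_in) auto
    moreover from this have "E m = E ?m"
      unfolding E_def by (auto intro: Max_ge order_trans)
    ultimately show ?thesis using bound_in[of ?m] by auto
  qed
  have "{\<omega> \<in> space \<Omega>. \<exists>M\<in>sizes s A. \<epsilon> < u_statistic ?g M (X \<omega>)} = (\<Union>m. E m)"
    by (auto simp: E_def)
  moreover have "incseq E" unfolding E_def incseq_def by fastforce
  ultimately show ?thesis
    using SUP_emeasure_incseq[of E \<Omega>] E_sets bound
    by (metis (no_types, lifting) SUP_least image_subsetI)
qed

section \<open>Measurability of the risks\<close>

lemma measurable_residual:
  assumes f: "(\<lambda>(x, d). f x (subdata d B)) \<in> borel_measurable (feature_space p \<Otimes>\<^sub>M N)"
    and d: "d \<in> space N" and P: "sets P = sets (obs_space p)"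
  shows "residual f d B \<in> borel_measurable P"
proof -
  have "(\<lambda>z. (fst z, d)) \<in> obs_space p \<rightarrow>\<^sub>M feature_space p \<Otimes>\<^sub>M N"
    unfolding obs_space_def using d by measurable
  from measurable_compose[OF this f]
  have "(\<lambda>z. f (fst z) (subdata d B)) \<in> borel_measurable (obs_space p)"
    by simp
  then have "residual f d B \<in> borel_measurable (obs_space p)"
    unfolding residual_def[abs_def] by (rule borel_measurable_diff[rotated]) (simp add: obs_space_def)
  then show ?thesis
    using measurable_cong_sets[OF P refl] by blast
qed

text \<open>
  The predictor is assumed measurable in the data only for each fixed bag; a random bag is harmless
  since it takes finitely many values.
\<close>

lemma measurable_subsample_risk:
  assumes f: "\<And>B. B \<in> A \<Longrightarrow>
      (\<lambda>(x, d). f x (subdata d B)) \<in> borel_measurable (feature_space p \<Otimes>\<^sub>M N)"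
    and A: "finite A" and L: "{1..M} \<subseteq> L"
    and P: "prob_space P" "sets P = sets (obs_space p)"
  shows "(\<lambda>(d, S). subsample_risk P f d M S) \<in> borel_measurable (N \<Otimes>\<^sub>M draw_space A L)"
proof -
  interpret prob_space P by fact
  let ?N = "(N \<Otimes>\<^sub>M draw_space A L) \<Otimes>\<^sub>M P"
  have sets_N: "sets ?N = sets ((N \<Otimes>\<^sub>M draw_space A L) \<Otimes>\<^sub>M obs_space p)"
    using P(2) by (rule sets_pair_measure_cong[OF refl])
  have pred: "(\<lambda>w. f (fst (snd w)) (subdata (fst (fst w)) (snd (fst w) i))) \<in> borel_measurable ?N"
    if i: "i \<in> {1..M}" for i
  proof (rule measurable_compose_countable'[where I = A and g = "\<lambda>w. snd (fst w) i"])
    have comp: "(\<lambda>S. S i) \<in> draw_space A L \<rightarrow>\<^sub>M count_space A"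
      unfolding draw_space_def by (rule measurable_component_singleton) (use i L in auto)
    show "(\<lambda>w. snd (fst w) i) \<in> ?N \<rightarrow>\<^sub>M count_space A"
      by (rule measurable_compose[OF _ comp]) measurable
    fix B assume B: "B \<in> A"
    have "(\<lambda>w. (fst (snd w), fst (fst w))) \<in> ?N \<rightarrow>\<^sub>M feature_space p \<Otimes>\<^sub>M N"
      unfolding measurable_cong_sets[OF sets_N refl] obs_space_def by measurable
    from measurable_compose[OF this f[OF B]]
    show "(\<lambda>w. f (fst (snd w)) (subdata (fst (fst w)) B)) \<in> borel_measurable ?N"
      by simp
  qed (use A in \<open>auto intro: countable_finite\<close>)
  have y: "(\<lambda>w. snd (snd w)) \<in> borel_measurable ?N"
    unfolding measurable_cong_sets[OF sets_N refl] obs_space_def by measurable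
  have "(\<lambda>w. ennreal ((snd (snd w) - bagged f (fst (fst w)) M (snd (fst w)) (fst (snd w)))\<^sup>2))
      \<in> borel_measurable ?N"
    unfolding bagged_def
    by (intro measurable_compose[OF _ measurable_ennreal] borel_measurable_power
        borel_measurable_diff y borel_measurable_divide borel_measurable_sum pred
        borel_measurable_const)
  from borel_measurable_nn_integral_fst[OF this]
  show ?thesis
    by (simp add: subsample_risk_def[abs_def] case_prod_unfold)
qed

lemma measurable_deviation:
  assumes "r \<in> borel_measurable N"
  shows "(\<lambda>x. deviation (r x) c) \<in> borel_measurable N"
  using assms unfolding deviation_def by measurable

section \<open>Independence and Fubini\<close>

text \<open>
  Evaluating \<open>Y\<close> at a second sample point \<open>\<omega>'\<close> provides an independent copy of it: the joint law
  of independent variables is the product of their laws, to which Fubini's theorem applies.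
\<close>

lemma indep_rv_emeasure:
  assumes prob: "prob_space \<Omega>" and ind: "indep_rv \<Omega> N X N' Y"
    and Q: "{z \<in> space (N \<Otimes>\<^sub>M N'). Q (fst z) (snd z)} \<in> sets (N \<Otimes>\<^sub>M N')"
  shows "emeasure \<Omega> {\<omega> \<in> space \<Omega>. Q (X \<omega>) (Y \<omega>)}
      = (\<integral>\<^sup>+\<omega>. emeasure \<Omega> {\<omega>' \<in> space \<Omega>. Q (X \<omega>) (Y \<omega>')} \<partial>\<Omega>)"
    and "(\<lambda>\<omega>. emeasure \<Omega> {\<omega>' \<in> space \<Omega>. Q (X \<omega>) (Y \<omega>')}) \<in> borel_measurable \<Omega>"
proof -
  interpret prob_space \<Omega> by fact
  have X: "X \<in> \<Omega> \<rightarrow>\<^sub>M N" and Y: "Y \<in> \<Omega> \<rightarrow>\<^sub>M N'"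
    and indep: "indep_set {X -` B \<inter> space \<Omega> | B. B \<in> sets N} {Y -` B \<inter> space \<Omega> | B. B \<in> sets N'}"
    using ind by (auto simp: indep_rv_def)
  interpret dX: prob_space "distr \<Omega> N X" using X by (rule prob_space_distr)
  interpret dY: prob_space "distr \<Omega> N' Y" using Y by (rule prob_space_distr)
  have XY: "(\<lambda>\<omega>. (X \<omega>, Y \<omega>)) \<in> \<Omega> \<rightarrow>\<^sub>M N \<Otimes>\<^sub>M N'" using X Y by measurable
  have law: "distr \<Omega> N X \<Otimes>\<^sub>M distr \<Omega> N' Y = distr \<Omega> (N \<Otimes>\<^sub>M N') (\<lambda>\<omega>. (X \<omega>, Y \<omega>))"
  proof (rule pair_measure_eqI)
    fix A B assume "A \<in> sets (distr \<Omega> N X)" "B \<in> sets (distr \<Omega> N' Y)"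
    then have A: "A \<in> sets N" and B: "B \<in> sets N'" by auto
    have "(\<lambda>\<omega>. (X \<omega>, Y \<omega>)) -` (A \<times> B) \<inter> space \<Omega>
        = (X -` A \<inter> space \<Omega>) \<inter> (Y -` B \<inter> space \<Omega>)" by auto
    moreover have "prob ((X -` A \<inter> space \<Omega>) \<inter> (Y -` B \<inter> space \<Omega>))
        = prob (X -` A \<inter> space \<Omega>) * prob (Y -` B \<inter> space \<Omega>)"
      by (rule indep_setD[OF indep]) (use A B in auto)
    ultimately show "emeasure (distr \<Omega> N X) A * emeasure (distr \<Omega> N' Y) B
        = emeasure (distr \<Omega> (N \<Otimes>\<^sub>M N') (\<lambda>\<omega>. (X \<omega>, Y \<omega>))) (A \<times> B)"
      using A B by (simp add: emeasure_distr X Y XY emeasure_eq_measure ennreal_mult)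
  qed (auto intro: dX.sigma_finite_measure dY.sigma_finite_measure sets_pair_measure_cong)
  let ?Z = "{z \<in> space (N \<Otimes>\<^sub>M N'). Q (fst z) (snd z)}"
  have slice: "emeasure (distr \<Omega> N' Y) (Pair (X \<omega>) -` ?Z)
      = emeasure \<Omega> {\<omega>' \<in> space \<Omega>. Q (X \<omega>) (Y \<omega>')}" if "\<omega> \<in> space \<Omega>" for \<omega>
  proof -
    have "Pair (X \<omega>) -` ?Z \<in> sets N'" using Q by (rule sets_Pair1)
    moreover have "Y -` (Pair (X \<omega>) -` ?Z) \<inter> space \<Omega> = {\<omega>' \<in> space \<Omega>. Q (X \<omega>) (Y \<omega>')}"
      using measurable_space[OF X that] measurable_space[OF Y] by (auto simp: space_pair_measure)
    ultimately show ?thesis by (simp add: emeasure_distr Y)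
  qed
  have meas: "(\<lambda>x. emeasure (distr \<Omega> N' Y) (Pair x -` ?Z)) \<in> borel_measurable N"
    using Q by (intro dY.measurable_emeasure_Pair) (simp cong: sets_pair_measure_cong)
  have "emeasure \<Omega> {\<omega> \<in> space \<Omega>. Q (X \<omega>) (Y \<omega>)}
      = emeasure (distr \<Omega> (N \<Otimes>\<^sub>M N') (\<lambda>\<omega>. (X \<omega>, Y \<omega>))) ?Z"
  proof -
    have "(\<lambda>\<omega>. (X \<omega>, Y \<omega>)) -` ?Z \<inter> space \<Omega> = {\<omega> \<in> space \<Omega>. Q (X \<omega>) (Y \<omega>)}"
      using measurable_space[OF XY] by auto
    then show ?thesis using Q by (simp add: emeasure_distr XY)
  qed
  also have "\<dots> = (\<integral>\<^sup>+x. emeasure (distr \<Omega> N' Y) (Pair x -` ?Z) \<partial>distr \<Omega> N X)"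
    unfolding law[symmetric] using Q
    by (intro dY.emeasure_pair_measure_alt) (simp cong: sets_pair_measure_cong)
  also have "\<dots> = (\<integral>\<^sup>+\<omega>. emeasure (distr \<Omega> N' Y) (Pair (X \<omega>) -` ?Z) \<partial>\<Omega>)"
    using meas by (intro nn_integral_distr X) simp
  also have "\<dots> = (\<integral>\<^sup>+\<omega>. emeasure \<Omega> {\<omega>' \<in> space \<Omega>. Q (X \<omega>) (Y \<omega>')} \<partial>\<Omega>)"
    by (rule nn_integral_cong) (rule slice)
  finally show "emeasure \<Omega> {\<omega> \<in> space \<Omega>. Q (X \<omega>) (Y \<omega>)}
      = (\<integral>\<^sup>+\<omega>. emeasure \<Omega> {\<omega>' \<in> space \<Omega>. Q (X \<omega>) (Y \<omega>')} \<partial>\<Omega>)" .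
  from measurable_compose[OF X meas]
  show "(\<lambda>\<omega>. emeasure \<Omega> {\<omega>' \<in> space \<Omega>. Q (X \<omega>) (Y \<omega>')}) \<in> borel_measurable \<Omega>"
    by (subst measurable_cong[OF slice[symmetric]])
qed

lemma indep_rv_AE:
  assumes prob: "prob_space \<Omega>" and ind: "indep_rv \<Omega> N X N' Y"
    and Q: "{z \<in> space (N \<Otimes>\<^sub>M N'). Q (fst z) (snd z)} \<in> sets (N \<Otimes>\<^sub>M N')"
    and ae: "AE \<omega> in \<Omega>. Q (X \<omega>) (Y \<omega>)"
  shows "AE \<omega> in \<Omega>. AE \<omega>' in \<Omega>. Q (X \<omega>) (Y \<omega>')"
proof -
  have X: "X \<in> \<Omega> \<rightarrow>\<^sub>M N" and Y: "Y \<in> \<Omega> \<rightarrow>\<^sub>M N'" using ind by (auto simp: indep_rv_def)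
  let ?Z = "{z \<in> space (N \<Otimes>\<^sub>M N'). \<not> Q (fst z) (snd z)}"
  have Z: "?Z \<in> sets (N \<Otimes>\<^sub>M N')" using Q by (rule sets.sets_Collect_neg)
  have sec: "{\<omega>' \<in> space \<Omega>. \<not> Q (X \<omega>) (Y \<omega>')} \<in> sets \<Omega>" if "\<omega> \<in> space \<Omega>" for \<omega>
  proof -
    have "(\<lambda>\<omega>'. (X \<omega>, Y \<omega>')) \<in> \<Omega> \<rightarrow>\<^sub>M N \<Otimes>\<^sub>M N'"
      using measurable_space[OF X that] Y by measurable
    from measurable_sets[OF this Z]
    have "(\<lambda>\<omega>'. (X \<omega>, Y \<omega>')) -` ?Z \<inter> space \<Omega> \<in> sets \<Omega>" .
    moreover have "(\<lambda>\<omega>'. (X \<omega>, Y \<omega>')) -` ?Z \<inter> space \<Omega> = {\<omega>' \<in> space \<Omega>. \<not> Q (X \<omega>) (Y \<omega>')}"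
      using measurable_space[OF X that] measurable_space[OF Y] by (auto simp: space_pair_measure)
    ultimately show ?thesis by simp
  qed
  have "(\<lambda>\<omega>. (X \<omega>, Y \<omega>)) \<in> \<Omega> \<rightarrow>\<^sub>M N \<Otimes>\<^sub>M N'" using X Y by measurable
  from measurable_sets[OF this Z]
  have "(\<lambda>\<omega>. (X \<omega>, Y \<omega>)) -` ?Z \<inter> space \<Omega> \<in> sets \<Omega>" .
  moreover have "(\<lambda>\<omega>. (X \<omega>, Y \<omega>)) -` ?Z \<inter> space \<Omega> = {\<omega> \<in> space \<Omega>. \<not> Q (X \<omega>) (Y \<omega>)}"
    using measurable_space[OF X] measurable_space[OF Y] by (auto simp: space_pair_measure)
  ultimately have sec0: "{\<omega> \<in> space \<Omega>. \<not> Q (X \<omega>) (Y \<omega>)} \<in> sets \<Omega>" by simp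
  have "emeasure \<Omega> {\<omega> \<in> space \<Omega>. \<not> Q (X \<omega>) (Y \<omega>)} = 0"
    using ae AE_iff_measurable[OF sec0 refl] by simp
  then have "(\<integral>\<^sup>+\<omega>. emeasure \<Omega> {\<omega>' \<in> space \<Omega>. \<not> Q (X \<omega>) (Y \<omega>')} \<partial>\<Omega>) = 0"
    using indep_rv_emeasure(1)[OF prob ind Z] by simp
  then have ae0: "AE \<omega> in \<Omega>. emeasure \<Omega> {\<omega>' \<in> space \<Omega>. \<not> Q (X \<omega>) (Y \<omega>')} = 0"
    using nn_integral_0_iff_AE[OF indep_rv_emeasure(2)[OF prob ind Z]] by simp
  show ?thesis
  proof (rule AE_mp[OF ae0], rule AE_I2, rule impI)
    fix \<omega> assume "\<omega> \<in> space \<Omega>" "emeasure \<Omega> {\<omega>' \<in> space \<Omega>. \<not> Q (X \<omega>) (Y \<omega>')} = 0"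
    then show "AE \<omega>' in \<Omega>. Q (X \<omega>) (Y \<omega>')"
      using AE_iff_measurable[OF sec refl] by simp
  qed
qed

section \<open>Convergence of single and pairwise risks\<close>

lemma tendsto_0_erealI:
  fixes f :: "'a \<Rightarrow> ereal"
  assumes "\<And>x. 0 \<le> f x" "\<And>\<delta>. 0 < \<delta> \<Longrightarrow> \<forall>\<^sub>F x in F. f x \<le> ereal \<delta>"
  shows "(f \<longlongrightarrow> 0) F"
proof (rule order_tendstoI)
  fix a :: ereal assume "a < 0"
  then show "\<forall>\<^sub>F x in F. a < f x" using assms(1) by (auto intro: always_eventually less_le_trans)
next
  fix a :: ereal assume "0 < a"
  then obtain \<delta> where "0 < ereal \<delta>" "ereal \<delta> < a" using ereal_dense2 by blast
  then show "\<forall>\<^sub>F x in F. f x < a"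
    using assms(2)[of \<delta>] by (auto elim: eventually_mono intro: le_less_trans)
qed

lemma sets_Collect_tendsto_0:
  fixes f :: "nat \<Rightarrow> 'a \<Rightarrow> ereal"
  assumes [measurable]: "\<And>n. f n \<in> borel_measurable N" and nonneg: "\<And>n x. 0 \<le> f n x"
  shows "{x \<in> space N. (\<lambda>n. f n x) \<longlonglongrightarrow> 0} \<in> sets N"
proof -
  have "(\<lambda>n. f n x) \<longlonglongrightarrow> 0 \<longleftrightarrow> limsup (\<lambda>n. f n x) \<le> 0" for x
  proof
    assume "(\<lambda>n. f n x) \<longlonglongrightarrow> 0"
    then show "limsup (\<lambda>n. f n x) \<le> 0" by (simp add: lim_imp_Limsup)
  next
    assume *: "limsup (\<lambda>n. f n x) \<le> 0"
    have "0 \<le> liminf (\<lambda>n. f n x)" by (rule Liminf_bounded) (simp add: nonneg)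
    moreover have "liminf (\<lambda>n. f n x) \<le> limsup (\<lambda>n. f n x)" by (rule Liminf_le_Limsup) simp
    ultimately show "(\<lambda>n. f n x) \<longlonglongrightarrow> 0"
      using * by (intro Liminf_eq_Limsup) auto
  qed
  then show ?thesis by simp
qed

text \<open>
  A random index may depend on everything, so it can be chosen to maximise \<open>V n\<close>, and convergence
  along this choice is uniform convergence.  Taking the first maximiser in a fixed enumeration of
  \<open>A n\<close> makes the choice measurable.
\<close>

lemma uniform_convergence_of_random_selections:
  fixes V :: "nat \<Rightarrow> 'b \<Rightarrow> 'w \<Rightarrow> ereal"
  assumes A: "\<And>n. 1 \<le> n \<Longrightarrow> finite (A n) \<and> A n \<noteq> {}"
    and V: "\<And>n B. 1 \<le> n \<Longrightarrow> B \<in> A n \<Longrightarrow> V n B \<in> borel_measurable \<Omega>"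
    and sel: "\<And>S. (\<And>n. 1 \<le> n \<Longrightarrow> S n \<in> \<Omega> \<rightarrow>\<^sub>M count_space (A n))
      \<Longrightarrow> AE \<omega> in \<Omega>. (\<lambda>n. V n (S n \<omega>) \<omega>) \<longlonglongrightarrow> 0"
  shows "AE \<omega> in \<Omega>. \<forall>\<delta>>0. \<forall>\<^sub>F n in sequentially. \<forall>B\<in>A n. V n B \<omega> \<le> ereal \<delta>"
proof -
  define e where "e n = from_nat_into (A n)" for n
  define S where "S n \<omega> = e n (LEAST i. \<forall>B\<in>A n. V n B \<omega> \<le> V n (e n i) \<omega>)" for n \<omega>
  have e_in: "e n i \<in> A n" if "1 \<le> n" for n i
    unfolding e_def using A[OF that] from_nat_into[of "A n" i] by simp
  have S_meas: "S n \<in> \<Omega> \<rightarrow>\<^sub>M count_space (A n)" if n: "1 \<le> n" for n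
  proof -
    have "(\<lambda>\<omega>. LEAST i. \<forall>B\<in>A n. V n B \<omega> \<le> V n (e n i) \<omega>) \<in> \<Omega> \<rightarrow>\<^sub>M count_space UNIV"
    proof (rule measurable_Least)
      fix i
      have "{\<omega> \<in> space \<Omega>. V n B \<omega> \<le> V n (e n i) \<omega>} \<in> sets \<Omega>" if "B \<in> A n" for B
        by (rule borel_measurable_le) (use V e_in n that in blast)+
      then show "Measurable.pred \<Omega> (\<lambda>\<omega>. \<forall>B\<in>A n. V n B \<omega> \<le> V n (e n i) \<omega>)"
        unfolding pred_def using A[OF n] by (intro sets.sets_Collect_finite_All) auto
    qed
    then show ?thesis
      unfolding S_def by (rule measurable_compose) (use e_in[OF n] in auto)
  qed
  show ?thesis
  proof (rule AE_mp[OF sel[OF S_meas]], assumption, rule AE_I2, intro impI allI)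
    fix \<omega> and \<delta> :: real
    assume lim: "(\<lambda>n. V n (S n \<omega>) \<omega>) \<longlonglongrightarrow> 0" and "0 < \<delta>"
    then have "\<forall>\<^sub>F n in sequentially. V n (S n \<omega>) \<omega> < ereal \<delta>"
      by (intro order_tendstoD(2)[OF lim]) simp
    moreover have "\<forall>\<^sub>F n in sequentially. 1 \<le> n" by (rule eventually_ge_at_top)
    ultimately show "\<forall>\<^sub>F n in sequentially. \<forall>B\<in>A n. V n B \<omega> \<le> ereal \<delta>"
    proof eventually_elim
      case (elim n)
      have "\<exists>i. \<forall>B\<in>A n. V n B \<omega> \<le> V n (e n i) \<omega>"
      proof -
        have "Max ((\<lambda>B. V n B \<omega>) ` A n) \<in> (\<lambda>B. V n B \<omega>) ` A n"
          using A[OF elim(2)] by (intro Max_in) auto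
        then obtain B0 where B0: "B0 \<in> A n" "Max ((\<lambda>B. V n B \<omega>) ` A n) = V n B0 \<omega>" by auto
        have "V n B \<omega> \<le> V n B0 \<omega>" if "B \<in> A n" for B
          using A[OF elim(2)] that B0(2)[symmetric] by simp
        moreover obtain i where "e n i = B0"
          unfolding e_def using from_nat_into_surj[OF countable_finite B0(1)] A[OF elim(2)] by blast
        ultimately show ?thesis by blast
      qed
      from LeastI_ex[OF this] have "\<forall>B\<in>A n. V n B \<omega> \<le> V n (S n \<omega>) \<omega>" by (simp add: S_def)
      with elim(1) show ?case by (meson less_imp_le order_trans)
    qed
  qed
qed

lemma cross_risk_commute: "cross_risk P f d B C = cross_risk P f d C B"
  by (simp add: cross_risk_def mult.commute)

text \<open>
  By polarization: four times the risk of a pair is the sum of its two diagonal cross risks and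
  twice its off-diagonal one.
\<close>

lemma cross_deviation_le:
  assumes res: "\<And>B. B \<in> A \<Longrightarrow> residual f d B \<in> borel_measurable P"
    and risk1: "\<And>B. B \<in> A \<Longrightarrow> deviation (subsample_risk P f d 1 (\<lambda>_. B)) b1 \<le> ereal \<delta>"
    and S: "S 1 \<in> A" "S 2 \<in> A"
    and risk2: "deviation (subsample_risk P f d 2 S) b2 \<le> ereal e"
  shows "cross_deviation P f d (2 * b2 - b1) (S 1) (S 2) \<le> 2 * e + \<delta>"
proof -
  have fin: "subsample_risk P f d 1 (\<lambda>_. B) < \<infinity>" if "B \<in> A" for B
    using risk1[OF that] by (rule deviation_le_imp_finite)
  have diag: "\<bar>cross_risk P f d B B - b1\<bar> \<le> \<delta>" if "B \<in> A" for B
    by (rule cross_risk_diagonal[OF res risk1 that])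
  have S': "S i \<in> A" if "i \<in> {1..2}" for i
  proof -
    have "i = 1 \<or> i = 2" using that by auto
    with S show ?thesis by auto
  qed
  let ?R = "(\<Sum>i=1..2. \<Sum>j=1..2. cross_risk P f d (S i) (S j)) / (real 2)\<^sup>2"
  have "subsample_risk P f d 2 S = ennreal ?R"
    by (rule subsample_risk_cross_risk(1)[where A = A]) (use res fin S' in auto)
  moreover have "0 \<le> ?R"
    by (rule subsample_risk_cross_risk(2)[where A = A]) (use res fin S' in auto)
  ultimately have "\<bar>?R - b2\<bar> \<le> e"
    using risk2 by (simp only: deviation_ennreal ereal_less_eq)
  moreover have "4 * ?R = cross_risk P f d (S 1) (S 1) + cross_risk P f d (S 2) (S 2)
      + 2 * cross_risk P f d (S 1) (S 2)"
    using cross_risk_commute[of P f d "S 2" "S 1"] by (simp add: numeral_2_eq_2)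
  ultimately show ?thesis
    using diag[OF S(1)] diag[OF S(2)]
    unfolding cross_deviation_def by linarith
qed

lemma cross_deviation_bounded:
  assumes res: "\<And>B. B \<in> A \<Longrightarrow> residual f d B \<in> borel_measurable P"
    and risk1: "\<And>B. B \<in> A \<Longrightarrow> deviation (subsample_risk P f d 1 (\<lambda>_. B)) b1 \<le> ereal \<delta>"
    and BC: "B \<in> A" "C \<in> A"
  shows "cross_deviation P f d c B C \<le> \<bar>b1\<bar> + \<delta> + \<bar>c\<bar>"
proof -
  have fin: "subsample_risk P f d 1 (\<lambda>_. B) < \<infinity>" if "B \<in> A" for B
    using risk1[OF that] by (rule deviation_le_imp_finite)
  have diag: "\<bar>cross_risk P f d B B - b1\<bar> \<le> \<delta>" if "B \<in> A" for B
    by (rule cross_risk_diagonal[OF res risk1 that])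
  note int = integrable_residual_mult[of f d _ P, OF res res fin fin]
  have am_gm: "\<bar>a * b\<bar> \<le> (a * a + b * b) / 2" for a b :: real
    using sum_squares_bound[of "\<bar>a\<bar>" "\<bar>b\<bar>"] by (simp add: abs_mult power2_eq_square)
  have "\<bar>cross_risk P f d B C\<bar> \<le> (\<integral>z. \<bar>residual f d B z * residual f d C z\<bar> \<partial>P)"
    unfolding cross_risk_def by (rule integral_abs_bound)
  also have "\<dots> \<le> (\<integral>z. (residual f d B z * residual f d B z
      + residual f d C z * residual f d C z) / 2 \<partial>P)"
    by (intro integral_mono integrable_abs Bochner_Integration.integrable_divide
        Bochner_Integration.integrable_add int BC am_gm)
  also have "\<dots> = (cross_risk P f d B B + cross_risk P f d C C) / 2"
    unfolding cross_risk_def by (simp add: Bochner_Integration.integral_add int BC)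
  also have "\<dots> \<le> \<bar>b1\<bar> + \<delta>"
    using abs_ge_self[of b1] diag[OF BC(1), unfolded abs_le_iff] diag[OF BC(2), unfolded abs_le_iff]
    by argo
  finally show ?thesis
    using abs_triangle_ineq4[of "cross_risk P f d B C" c]
    unfolding cross_deviation_def by linarith
qed

text \<open>
  With the data held fixed, almost sure convergence along the random pair turns into convergence of
  the average over pairs, because cross risks are eventually bounded.
\<close>

lemma pair_deviation_tendsto_0:
  assumes prob: "prob_space \<Omega>"
    and A: "\<And>n. 1 \<le> n \<Longrightarrow> finite (A n)"
    and res: "\<And>n B. 1 \<le> n \<Longrightarrow> B \<in> A n \<Longrightarrow> residual (f n) (d n) B \<in> borel_measurable (P n)"
    and risk1: "\<And>\<delta>. 0 < \<delta> \<Longrightarrow> \<forall>\<^sub>F n in sequentially. \<forall>B\<in>A n.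
      deviation (subsample_risk (P n) (f n) (d n) 1 (\<lambda>_. B)) b1 \<le> ereal \<delta>"
    and J: "\<And>n. 1 \<le> n \<Longrightarrow> simple_random_sample \<Omega> s (A n) (sizes s (A n) \<inter> {1, 2}) (J n)"
    and risk2: "AE \<omega> in \<Omega>. (\<lambda>n. if 2 \<in> sizes s (A n)
      then deviation (subsample_risk (P n) (f n) (d n) 2 (J n \<omega>)) b2 else 0) \<longlonglongrightarrow> 0"
  shows "(\<lambda>n. pair_deviation (P n) (f n) (d n) s (A n) (2 * b2 - b1)) \<longlonglongrightarrow> 0"
proof -
  interpret prob_space \<Omega> by fact
  let ?\<gamma> = "2 * b2 - b1"
  have "\<forall>\<^sub>F n in sequentially. 1 \<le> n \<and> (\<forall>B\<in>A n.
      deviation (subsample_risk (P n) (f n) (d n) 1 (\<lambda>_. B)) b1 \<le> ereal 1)"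
    by (rule eventually_conj[OF eventually_ge_at_top risk1]) simp
  then obtain N where N: "1 \<le> n"
      "\<forall>B\<in>A n. deviation (subsample_risk (P n) (f n) (d n) 1 (\<lambda>_. B)) b1 \<le> ereal 1"
    if "N \<le> n" for n
    unfolding eventually_sequentially by blast
  (* Before N the cross risks need not have a common bound, so these terms are set to zero. *)
  define G where "G n \<omega> = (if N \<le> n \<and> 2 \<in> sizes s (A n)
    then cross_deviation (P n) (f n) (d n) ?\<gamma> (J n \<omega> 1) (J n \<omega> 2) else 0)" for n \<omega>
  have sub: "{1..2} \<subseteq> sizes s (A n) \<inter> {1, 2}" if "2 \<in> sizes s (A n)" for n
    using that sizes_downward[OF that, of 1] by (auto simp: le_Suc_eq numeral_2_eq_2)
  have J_in: "J n \<omega> 1 \<in> A n" "J n \<omega> 2 \<in> A n"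
    if "1 \<le> n" "2 \<in> sizes s (A n)" "\<omega> \<in> space \<Omega>" for n \<omega>
  proof -
    have "1 \<in> sizes s (A n) \<inter> {1, 2}" "2 \<in> sizes s (A n) \<inter> {1, 2}"
      using that(2) sizes_downward[OF that(2), of 1] by auto
    then show "J n \<omega> 1 \<in> A n" "J n \<omega> 2 \<in> A n"
      using measurable_space[OF simple_random_sample_component[OF J[OF that(1)]] that(3)] by auto
  qed
  have G_meas: "G n \<in> borel_measurable \<Omega>" for n
  proof (cases "N \<le> n \<and> 2 \<in> sizes s (A n)")
    case True
    then have n: "1 \<le> n" using N by auto
    let ?h = "\<lambda>S. cross_deviation (P n) (f n) (d n) ?\<gamma> (S 1) (S 2)"
    have "(\<lambda>\<omega>. ?h (restrict (J n \<omega>) {1..2})) \<in> borel_measurable \<Omega>"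
      using True by (intro measurable_compose[OF simple_random_sample_prefix_measurable
          [OF J[OF n] A[OF n] sub] borel_measurable_count_space]) auto
    then show ?thesis using True by (simp add: G_def[abs_def])
  next
    case False
    then have "G n = (\<lambda>_. 0)" unfolding G_def by (intro ext if_not_P)
    then show ?thesis by simp
  qed
  have G_int: "pair_deviation (P n) (f n) (d n) s (A n) ?\<gamma> = (\<integral>\<omega>. G n \<omega> \<partial>\<Omega>)" if n: "N \<le> n" for n
  proof (cases "2 \<in> sizes s (A n)")
    case True
    have "(\<integral>\<omega>. cross_deviation (P n) (f n) (d n) ?\<gamma> (J n \<omega> 1) (J n \<omega> 2) \<partial>\<Omega>)
        = measure_pmf.expectation (draw_pmf s (A n) 2)
            (\<lambda>S. cross_deviation (P n) (f n) (d n) ?\<gamma> (S 1) (S 2))"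
      using sub[OF True]
      by (intro simple_random_sample_expectation[OF J[OF N(1)[OF n]] A[OF N(1)[OF n]]]) auto
    then show ?thesis using True n by (simp add: G_def pair_deviation_def)
  qed (simp add: G_def pair_deviation_def)
  have G_bound: "\<bar>G n \<omega>\<bar> \<le> \<bar>b1\<bar> + 1 + \<bar>?\<gamma>\<bar>" if "\<omega> \<in> space \<Omega>" for n \<omega>
  proof (cases "N \<le> n \<and> 2 \<in> sizes s (A n)")
    case True
    then have n: "1 \<le> n" using N by auto
    have "cross_deviation (P n) (f n) (d n) ?\<gamma> (J n \<omega> 1) (J n \<omega> 2) \<le> \<bar>b1\<bar> + 1 + \<bar>?\<gamma>\<bar>"
      by (rule cross_deviation_bounded[where A = "A n"])
        (use res[OF n] N(2)[of n] True J_in[OF n _ that] in auto)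
    then show ?thesis by (simp add: G_def cross_deviation_def)
  qed (auto simp: G_def)
  have "AE \<omega> in \<Omega>. (\<lambda>n. G n \<omega>) \<longlonglongrightarrow> 0"
  proof (rule AE_mp[OF risk2], rule AE_I2, rule impI)
    fix \<omega> assume \<omega>: "\<omega> \<in> space \<Omega>" and lim: "(\<lambda>n. if 2 \<in> sizes s (A n)
      then deviation (subsample_risk (P n) (f n) (d n) 2 (J n \<omega>)) b2 else 0) \<longlonglongrightarrow> 0"
    show "(\<lambda>n. G n \<omega>) \<longlonglongrightarrow> 0"
    proof (rule tendstoI)
      fix \<epsilon> :: real assume \<epsilon>: "0 < \<epsilon>"
      have "\<forall>\<^sub>F n in sequentially. (if 2 \<in> sizes s (A n)
          then deviation (subsample_risk (P n) (f n) (d n) 2 (J n \<omega>)) b2 else 0) < ereal (\<epsilon> / 4)"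
        by (rule order_tendstoD(2)[OF lim]) (use \<epsilon> in simp)
      moreover have "\<forall>\<^sub>F n in sequentially. \<forall>B\<in>A n.
          deviation (subsample_risk (P n) (f n) (d n) 1 (\<lambda>_. B)) b1 \<le> ereal (\<epsilon> / 4)"
        by (rule risk1) (use \<epsilon> in simp)
      ultimately show "\<forall>\<^sub>F n in sequentially. dist (G n \<omega>) 0 < \<epsilon>"
      proof eventually_elim
        case (elim n)
        show ?case
        proof (cases "N \<le> n \<and> 2 \<in> sizes s (A n)")
          case True
          then have n: "1 \<le> n" using N by auto
          have "cross_deviation (P n) (f n) (d n) ?\<gamma> (J n \<omega> 1) (J n \<omega> 2) \<le> 2 * (\<epsilon> / 4) + \<epsilon> / 4"
            by (rule cross_deviation_le[where A = "A n"])
              (use res[OF n] elim True J_in[OF n _ \<omega>] in auto)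
          then show ?thesis using True \<epsilon> by (simp add: G_def cross_deviation_def)
        qed (use \<epsilon> in \<open>auto simp: G_def\<close>)
      qed
    qed
  qed
  then have "(\<lambda>n. \<integral>\<omega>. G n \<omega> \<partial>\<Omega>) \<longlonglongrightarrow> (\<integral>\<omega>. 0 \<partial>\<Omega>)"
    by (intro integral_dominated_convergence[where w = "\<lambda>_. \<bar>b1\<bar> + 1 + \<bar>?\<gamma>\<bar>"])
      (use G_meas G_bound in \<open>auto intro!: AE_I2\<close>)
  then have lim: "(\<lambda>n. \<integral>\<omega>. G n \<omega> \<partial>\<Omega>) \<longlonglongrightarrow> 0" by simp
  have ev: "\<forall>\<^sub>F n in sequentially.
      (\<integral>\<omega>. G n \<omega> \<partial>\<Omega>) = pair_deviation (P n) (f n) (d n) s (A n) ?\<gamma>"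
    using eventually_ge_at_top[of N] by eventually_elim (simp add: G_int)
  show ?thesis using lim by (rule Lim_transform_eventually[OF _ ev])
qed

text \<open>
  Half of \<open>\<epsilon>\<close> is spent on the single risks, the other half is the threshold in the maximal
  inequality.
\<close>

lemma sup_deviation_tail:
  assumes prob: "prob_space \<Omega>" and X: "simple_random_sample \<Omega> s A (sizes s A) X"
    and A: "finite A" "A \<noteq> {}" and \<epsilon>: "0 < \<epsilon>"
    and res: "\<And>B. B \<in> A \<Longrightarrow> residual f d B \<in> borel_measurable P"
    and risk1: "\<And>B. B \<in> A \<Longrightarrow> deviation (subsample_risk P f d 1 (\<lambda>_. B)) b1 \<le> ereal (\<epsilon> / 2)"
  shows "emeasure \<Omega> {\<omega> \<in> space \<Omega>. ereal \<epsilon> < (SUP M\<in>sizes s A.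
      deviation (subsample_risk P f d M (X \<omega>)) ((2 * b2 - b1) + 2 * (b1 - b2) / real M))}
    \<le> ennreal (pair_deviation P f d s A (2 * b2 - b1) / (\<epsilon> / 2))"
proof -
  let ?u = "\<lambda>M \<omega>. u_statistic (cross_deviation P f d (2 * b2 - b1)) M (X \<omega>)"
  let ?E = "{\<omega> \<in> space \<Omega>. \<exists>M\<in>sizes s A. \<epsilon> / 2 < ?u M \<omega>}"
  have "?E = (\<Union>M\<in>sizes s A. {\<omega> \<in> space \<Omega>. \<epsilon> / 2 < ?u M \<omega>})" by auto
  also have "\<dots> \<in> sets \<Omega>"
  proof (rule sets.countable_UN'')
    show "{\<omega> \<in> space \<Omega>. \<epsilon> / 2 < ?u M \<omega>} \<in> sets \<Omega>" if "M \<in> sizes s A" for M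
      using u_statistic_sample_measurable[OF X A(1) that] by (intro borel_measurable_less) auto
  qed simp
  finally have E: "?E \<in> sets \<Omega>" .
  have "{\<omega> \<in> space \<Omega>. ereal \<epsilon> < (SUP M\<in>sizes s A.
      deviation (subsample_risk P f d M (X \<omega>)) ((2 * b2 - b1) + 2 * (b1 - b2) / real M))} \<subseteq> ?E"
  proof (intro subsetI)
    fix \<omega> assume \<omega>: "\<omega> \<in> {\<omega> \<in> space \<Omega>. ereal \<epsilon> < (SUP M\<in>sizes s A.
      deviation (subsample_risk P f d M (X \<omega>)) ((2 * b2 - b1) + 2 * (b1 - b2) / real M))}"
    then obtain M where M: "M \<in> sizes s A" and "ereal \<epsilon> < deviation
        (subsample_risk P f d M (X \<omega>)) ((2 * b2 - b1) + 2 * (b1 - b2) / real M)"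
      by (auto simp: less_SUP_iff)
    note this(2)
    also have "\<dots> \<le> ereal (\<epsilon> / 2 + ?u M \<omega>)"
    proof (rule subsample_risk_deviation_le[OF res risk1])
      show "1 \<le> M" using M by (cases s) (auto simp: sizes_def)
      show "X \<omega> i \<in> A" if "i \<in> {1..M}" for i
        using measurable_space[OF simple_random_sample_component[OF X, of i]]
          sizes_downward[OF M] that \<omega> by auto
    qed
    finally have "\<epsilon> / 2 < ?u M \<omega>" by simp
    with M \<omega> show "\<omega> \<in> ?E" by auto
  qed
  from emeasure_mono[OF this E] show ?thesis
    by (rule order_trans) (rule sample_maximal_inequality[OF prob X A], use \<epsilon> in simp)
qed

section \<open>Risk profiles of bagged predictors\<close>

lemma finite_bags: "finite (k_subsets n k)" "finite (perm_blocks n k \<pi>)"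
  by (auto simp: k_subsets_def perm_blocks_def)

lemma bags_nonempty:
  assumes "k \<in> {1..n}"
  shows "k_subsets n k \<noteq> {}" "perm_blocks n k \<pi> \<noteq> {}"
proof -
  have "{1..k} \<in> k_subsets n k" using assms by (auto simp: k_subsets_def)
  then show "k_subsets n k \<noteq> {}" by auto
  have "1 \<le> n div k" using assms div_le_mono[of k n k] by auto
  then show "perm_blocks n k \<pi> \<noteq> {}" by (auto simp: perm_blocks_def)
qed

lemma deviation_nonneg: "0 \<le> deviation r c"
  by (simp add: deviation_def)

theorem theorem2p9:
  fixes \<Omega> :: "'w measure"
    and p k :: "nat \<Rightarrow> nat"
    and \<pi> :: "nat \<Rightarrow> nat \<Rightarrow> nat"
    and D :: "nat \<Rightarrow> 'w \<Rightarrow> nat \<Rightarrow> obs"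
    and P :: "nat \<Rightarrow> obs measure"
    and fhat :: "nat \<Rightarrow> predictor"
    and s :: scheme
    and bags :: "nat \<Rightarrow> nat set set"
    and I J :: "nat \<Rightarrow> 'w \<Rightarrow> nat \<Rightarrow> nat set"
    and b1 b2 :: real
  assumes prob: "prob_space \<Omega>"
    and k: "\<And>n. n \<ge> 1 \<Longrightarrow> k n \<in> {1..n}"
    and perm: "\<And>n. n \<ge> 1 \<Longrightarrow> \<pi> n permutes {1..n}"
    and bags: "bags = (\<lambda>n. k_subsets n (k n)) \<or> bags = (\<lambda>n. perm_blocks n (k n) (\<pi> n))"
    and data: "\<And>n. n \<ge> 1 \<Longrightarrow> D n \<in> \<Omega> \<rightarrow>\<^sub>M data_space n (p n)"
    and test: "\<And>n. n \<ge> 1 \<Longrightarrow> prob_space (P n) \<and> sets (P n) = sets (obs_space (p n))"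
    and fhat: "\<And>n S. n \<ge> 1 \<Longrightarrow> S \<in> bags n \<Longrightarrow>
      (\<lambda>(x, d). fhat n x (subdata d S))
        \<in> borel_measurable (feature_space (p n) \<Otimes>\<^sub>M data_space n (p n))"
    (* the sequence S of index sets may be random and may depend on the data *)
    and risk1: "\<And>S :: nat \<Rightarrow> 'w \<Rightarrow> nat set.
      (\<And>n. n \<ge> 1 \<Longrightarrow> S n \<in> \<Omega> \<rightarrow>\<^sub>M count_space (bags n)) \<Longrightarrow>
      AE \<omega> in \<Omega>. (\<lambda>n. deviation
          (subsample_risk (P n) (fhat n) (D n \<omega>) 1 (\<lambda>_. S n \<omega>)) b1) \<longlonglongrightarrow> 0"
    (* J n is a sample of size 2, or of size 1 if two draws without replacement are impossible *)
    and J_sample: "\<And>n. n \<ge> 1 \<Longrightarrow>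
      simple_random_sample \<Omega> s (bags n) (sizes s (bags n) \<inter> {1, 2}) (J n)"
    and J_indep: "indep_rv \<Omega>
      (\<Pi>\<^sub>M n\<in>{1..}. data_space n (p n)) (\<lambda>\<omega>. \<lambda>n\<in>{1..}. D n \<omega>)
      (\<Pi>\<^sub>M n\<in>{1..}. draw_space (bags n) (sizes s (bags n) \<inter> {1, 2})) (\<lambda>\<omega>. \<lambda>n\<in>{1..}. J n \<omega>)"
    (* the limit is taken along those n for which two draws are possible *)
    and risk2: "AE \<omega> in \<Omega>.
      ((\<lambda>n. deviation (subsample_risk (P n) (fhat n) (D n \<omega>) 2 (J n \<omega>)) b2) \<longlongrightarrow> 0)
        (inf sequentially (principal {n. 2 \<in> sizes s (bags n)}))"
    and I_sample: "\<And>n. n \<ge> 1 \<Longrightarrow>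
      simple_random_sample \<Omega> s (bags n) (sizes s (bags n)) (I n)"
    and I_indep: "\<And>n. n \<ge> 1 \<Longrightarrow> indep_rv \<Omega>
      (data_space n (p n)) (D n) (draw_space (bags n) (sizes s (bags n))) (I n)"
  shows "tendsto_0_in_prob \<Omega> (\<lambda>n \<omega>. SUP M\<in>sizes s (bags n).
           deviation (subsample_risk (P n) (fhat n) (D n \<omega>) M (I n \<omega>))
             ((2 * b2 - b1) + 2 * (b1 - b2) / real M)) \<and>
         (AE \<omega> in \<Omega>. (\<lambda>n. SUP M\<in>sizes s (bags n).
           deviation (data_risk (P n) (fhat n) (D n \<omega>) s (bags n) M)
             ((2 * b2 - b1) + 2 * (b1 - b2) / real M)) \<longlonglongrightarrow> 0)"
proof -
  interpret prob_space \<Omega> by fact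
  let ?\<gamma> = "2 * b2 - b1" and ?T = "\<lambda>M. (2 * b2 - b1) + 2 * (b1 - b2) / real M"
  have A: "finite (bags n)" "bags n \<noteq> {}" if "1 \<le> n" for n
    using bags finite_bags bags_nonempty[OF k[OF that]] by auto
  have size1: "1 \<in> sizes s (bags n)" if "1 \<le> n" for n
    using A[OF that] by (cases s) (auto simp: sizes_def Suc_le_eq card_gt_0_iff)
  have D_space: "D n \<omega> \<in> space (data_space n (p n))" if "1 \<le> n" "\<omega> \<in> space \<Omega>" for n \<omega>
    using measurable_space[OF data[OF that(1)] that(2)] .
  have res: "residual (fhat n) (D n \<omega>) B \<in> borel_measurable (P n)"
    if "1 \<le> n" "\<omega> \<in> space \<Omega>" "B \<in> bags n" for n \<omega> B
    using measurable_residual[OF fhat[OF that(1,3)] D_space[OF that(1,2)]] test[OF that(1)] by blast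
  have risk_meas: "(\<lambda>z. deviation (subsample_risk (P n) (fhat n) (fst z) M (snd z)) c)
      \<in> borel_measurable (data_space n (p n) \<Otimes>\<^sub>M draw_space (bags n) L)"
    if "1 \<le> n" "{1..M} \<subseteq> L" for n M L c
    using measurable_deviation[OF measurable_subsample_risk[OF fhat[OF that(1)] A(1)[OF that(1)] that(2)
        conjunct1[OF test[OF that(1)]] conjunct2[OF test[OF that(1)]]]]
    by (simp add: case_prod_unfold)

  (* An admissible S in risk1 may depend on the data, hence may pick the worst bag. *)
  have uniform: "AE \<omega> in \<Omega>. \<forall>\<delta>>0. \<forall>\<^sub>F n in sequentially. \<forall>B\<in>bags n.
      deviation (subsample_risk (P n) (fhat n) (D n \<omega>) 1 (\<lambda>_. B)) b1 \<le> ereal \<delta>"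
  proof (rule uniform_convergence_of_random_selections)
    show "finite (bags n) \<and> bags n \<noteq> {}" if "1 \<le> n" for n using A[OF that] by simp
    fix n B assume n: "1 \<le> n" and B: "B \<in> bags n"
    have "(\<lambda>\<omega>. (D n \<omega>, \<lambda>i\<in>{1..1::nat}. B)) \<in> \<Omega> \<rightarrow>\<^sub>M data_space n (p n) \<Otimes>\<^sub>M draw_space (bags n) {1..1}"
      using B by (intro measurable_Pair data n measurable_const)
        (auto simp: draw_space_def space_PiM)
    from measurable_compose[OF this risk_meas[OF n order_refl]]
    show "(\<lambda>\<omega>. deviation (subsample_risk (P n) (fhat n) (D n \<omega>) 1 (\<lambda>_. B)) b1)
        \<in> borel_measurable \<Omega>"
      by (simp add: subsample_risk_def bagged_def)
  qed (rule risk1)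

  (* Zero where no pair exists: convergence along the admissible n becomes ordinary convergence. *)
  define W where "W n d S = (if 1 \<le> n \<and> 2 \<in> sizes s (bags n)
    then deviation (subsample_risk (P n) (fhat n) d 2 S) b2 else 0)" for n d S
  (* Almost sure convergence is a property of the whole sequences of data and of draws, so Fubini's
     theorem is applied on the product of the two sequence spaces. *)
  have pairs: "AE \<omega> in \<Omega>. AE \<omega>' in \<Omega>. (\<lambda>n. W n (D n \<omega>) (J n \<omega>')) \<longlonglongrightarrow> 0"
  proof -
    let ?N = "\<Pi>\<^sub>M n\<in>{1..}. data_space n (p n)"
    let ?N' = "\<Pi>\<^sub>M n\<in>{1..}. draw_space (bags n) (sizes s (bags n) \<inter> {1, 2})"
    have W_meas: "(\<lambda>z. W n (fst z n) (snd z n)) \<in> borel_measurable (?N \<Otimes>\<^sub>M ?N')" for n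
    proof (cases "1 \<le> n \<and> 2 \<in> sizes s (bags n)")
      case True
      then have n: "1 \<le> n" and two: "2 \<in> sizes s (bags n)" by auto
      have sub: "{1..2} \<subseteq> sizes s (bags n) \<inter> {1, 2}"
        using size1[OF n] two by (auto simp: le_Suc_eq numeral_2_eq_2)
      have "(\<lambda>z. (fst z n, snd z n)) \<in> ?N \<Otimes>\<^sub>M ?N'
          \<rightarrow>\<^sub>M data_space n (p n) \<Otimes>\<^sub>M draw_space (bags n) (sizes s (bags n) \<inter> {1, 2})"
        using n by (intro measurable_Pair measurable_compose[OF measurable_fst]
            measurable_compose[OF measurable_snd] measurable_component_singleton) auto
      from measurable_compose[OF this risk_meas[OF n sub]]
      show ?thesis using True by (simp add: W_def)
    next
      case False
      then show ?thesis by (auto simp: W_def)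
    qed
    have "AE \<omega> in \<Omega>. (\<lambda>n. W n (D n \<omega>) (J n \<omega>)) \<longlonglongrightarrow> 0"
      using risk2
    proof eventually_elim
      case (elim \<omega>)
      have "(\<lambda>n. if n \<in> {n. 2 \<in> sizes s (bags n)}
          then deviation (subsample_risk (P n) (fhat n) (D n \<omega>) 2 (J n \<omega>)) b2 else 0) \<longlonglongrightarrow> 0"
        by (rule filterlim_If) (use elim in simp_all)
      moreover have "\<forall>\<^sub>F n in sequentially. (if n \<in> {n. 2 \<in> sizes s (bags n)}
          then deviation (subsample_risk (P n) (fhat n) (D n \<omega>) 2 (J n \<omega>)) b2 else 0)
          = W n (D n \<omega>) (J n \<omega>)"
        using eventually_ge_at_top[of 1] by eventually_elim (simp add: W_def)
      ultimately show ?case by (rule Lim_transform_eventually)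
    qed
    moreover have drop: "W n ((\<lambda>n\<in>{1..}. d n) n) ((\<lambda>n\<in>{1..}. S n) n) = W n (d n) (S n)" for n d S
      by (simp add: W_def)
    ultimately have "AE \<omega> in \<Omega>. (\<lambda>n. W n ((\<lambda>n\<in>{1..}. D n \<omega>) n) ((\<lambda>n\<in>{1..}. J n \<omega>) n)) \<longlonglongrightarrow> 0"
      by (simp only: drop)
    from indep_rv_AE[OF prob J_indep, where Q = "\<lambda>d S. (\<lambda>n. W n (d n) (S n)) \<longlonglongrightarrow> 0",
        OF sets_Collect_tendsto_0[OF W_meas] this]
    show ?thesis
      by (simp only: drop) (simp add: W_def deviation_nonneg)
  qed

  let ?\<eta> = "\<lambda>n \<omega>. pair_deviation (P n) (fhat n) (D n \<omega>) s (bags n) ?\<gamma>"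
  have good: "AE \<omega> in \<Omega>. (\<lambda>n. ?\<eta> n \<omega>) \<longlonglongrightarrow> 0 \<and> (\<forall>\<delta>>0. \<forall>\<^sub>F n in sequentially. \<forall>B\<in>bags n.
      deviation (subsample_risk (P n) (fhat n) (D n \<omega>) 1 (\<lambda>_. B)) b1 \<le> ereal \<delta>)"
  proof (rule AE_mp[OF AE_conjI[OF uniform pairs]], rule AE_I2, intro impI conjI)
    fix \<omega> assume \<omega>: "\<omega> \<in> space \<Omega>" and *: "(\<forall>\<delta>>0. \<forall>\<^sub>F n in sequentially. \<forall>B\<in>bags n.
      deviation (subsample_risk (P n) (fhat n) (D n \<omega>) 1 (\<lambda>_. B)) b1 \<le> ereal \<delta>)
      \<and> (AE \<omega>' in \<Omega>. (\<lambda>n. W n (D n \<omega>) (J n \<omega>')) \<longlonglongrightarrow> 0)"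
    have "AE \<omega>' in \<Omega>. (\<lambda>n. if 2 \<in> sizes s (bags n)
      then deviation (subsample_risk (P n) (fhat n) (D n \<omega>) 2 (J n \<omega>')) b2 else 0) \<longlonglongrightarrow> 0"
      using conjunct2[OF *]
    proof eventually_elim
      case (elim \<omega>')
      have "\<forall>\<^sub>F n in sequentially. W n (D n \<omega>) (J n \<omega>') = (if 2 \<in> sizes s (bags n)
          then deviation (subsample_risk (P n) (fhat n) (D n \<omega>) 2 (J n \<omega>')) b2 else 0)"
        using eventually_ge_at_top[of 1] by eventually_elim (simp add: W_def)
      with elim show ?case by (rule Lim_transform_eventually)
    qed
    then show "(\<lambda>n. ?\<eta> n \<omega>) \<longlonglongrightarrow> 0"
      using * by (intro pair_deviation_tendsto_0[OF prob A(1) res[OF _ \<omega>] _ J_sample]) auto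
    show "\<forall>\<delta>>0. \<forall>\<^sub>F n in sequentially. \<forall>B\<in>bags n.
      deviation (subsample_risk (P n) (fhat n) (D n \<omega>) 1 (\<lambda>_. B)) b1 \<le> ereal \<delta>"
      using * by blast
  qed

  (* The conditional probability of a large supremum given the data tends to 0 almost surely; its
     mean over the data then tends to 0 by dominated convergence. *)
  define h where "h n d S = (SUP M\<in>sizes s (bags n).
    deviation (subsample_risk (P n) (fhat n) d M S) (?T M))" for n d S
  have h_nonneg: "0 \<le> h n d S" if "1 \<le> n" for n d S
    unfolding h_def by (rule SUP_upper2[OF size1[OF that] deviation_nonneg])
  have h_meas: "(\<lambda>z. h n (fst z) (snd z)) \<in> borel_measurable
      (data_space n (p n) \<Otimes>\<^sub>M draw_space (bags n) (sizes s (bags n)))" if n: "1 \<le> n" for n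
    unfolding h_def
  proof (rule borel_measurable_SUP)
    fix M assume "M \<in> sizes s (bags n)"
    then have "{1..M} \<subseteq> sizes s (bags n)" using sizes_downward by auto
    then show "(\<lambda>z. deviation (subsample_risk (P n) (fhat n) (fst z) M (snd z)) (?T M))
        \<in> borel_measurable (data_space n (p n) \<Otimes>\<^sub>M draw_space (bags n) (sizes s (bags n)))"
      by (rule risk_meas[OF n])
  qed simp

  have "tendsto_0_in_prob \<Omega> (\<lambda>n \<omega>. h n (D n \<omega>) (I n \<omega>))"
    unfolding tendsto_0_in_prob_def
  proof (intro conjI allI impI)
    show "\<forall>\<^sub>F n in sequentially. (\<lambda>\<omega>. h n (D n \<omega>) (I n \<omega>)) \<in> borel_measurable \<Omega>"
      using eventually_ge_at_top[of 1]
    proof eventually_elim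
      case (elim n)
      have "(\<lambda>\<omega>. (D n \<omega>, I n \<omega>)) \<in> \<Omega>
          \<rightarrow>\<^sub>M data_space n (p n) \<Otimes>\<^sub>M draw_space (bags n) (sizes s (bags n))"
        using I_sample[OF elim] data[OF elim]
        by (intro measurable_Pair) (simp_all add: simple_random_sample_def)
      from measurable_compose[OF this h_meas[OF elim]] show ?case by simp
    qed
    fix \<epsilon> :: real assume \<epsilon>: "0 < \<epsilon>"
    define tail where "tail n \<omega> = (if 1 \<le> n
      then emeasure \<Omega> {\<omega>' \<in> space \<Omega>. ereal \<epsilon> < h n (D n \<omega>) (I n \<omega>')} else 0)" for n \<omega>
    have Q: "{z \<in> space (data_space n (p n) \<Otimes>\<^sub>M draw_space (bags n) (sizes s (bags n))).
        ereal \<epsilon> < h n (fst z) (snd z)}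
      \<in> sets (data_space n (p n) \<Otimes>\<^sub>M draw_space (bags n) (sizes s (bags n)))" if "1 \<le> n" for n
      using h_meas[OF that] by (intro borel_measurable_less) auto
    have "AE \<omega> in \<Omega>. (\<lambda>n. tail n \<omega>) \<longlonglongrightarrow> 0"
    proof (rule AE_mp[OF good], rule AE_I2, rule impI, elim conjE)
      fix \<omega> assume \<omega>: "\<omega> \<in> space \<Omega>" and \<eta>: "(\<lambda>n. ?\<eta> n \<omega>) \<longlonglongrightarrow> 0"
        and unif: "\<forall>\<delta>>0. \<forall>\<^sub>F n in sequentially. \<forall>B\<in>bags n.
          deviation (subsample_risk (P n) (fhat n) (D n \<omega>) 1 (\<lambda>_. B)) b1 \<le> ereal \<delta>"
      have upper: "(\<lambda>n. ennreal (?\<eta> n \<omega> / (\<epsilon> / 2))) \<longlonglongrightarrow> 0"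
        using tendsto_ennrealI[OF tendsto_divide[OF \<eta> tendsto_const[of "\<epsilon> / 2"]]] \<epsilon> by simp
      have "\<forall>\<^sub>F n in sequentially. \<forall>B\<in>bags n.
          deviation (subsample_risk (P n) (fhat n) (D n \<omega>) 1 (\<lambda>_. B)) b1 \<le> ereal (\<epsilon> / 2)"
        using unif \<epsilon> by simp
      then have "\<forall>\<^sub>F n in sequentially. tail n \<omega> \<le> ennreal (?\<eta> n \<omega> / (\<epsilon> / 2))"
        using eventually_ge_at_top[of 1]
      proof eventually_elim
        case (elim n)
        show ?case
          unfolding tail_def h_def if_P[OF elim(2)]
          by (rule sup_deviation_tail[OF prob I_sample[OF elim(2)] A[OF elim(2)] \<epsilon>
                res[OF elim(2) \<omega>]]) (use elim in auto)
      qed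
      then show "(\<lambda>n. tail n \<omega>) \<longlonglongrightarrow> 0"
        by (rule tendsto_sandwich[OF _ _ tendsto_const upper, rotated]) simp
    qed
    then have "(\<lambda>n. \<integral>\<^sup>+\<omega>. tail n \<omega> \<partial>\<Omega>) \<longlonglongrightarrow> (\<integral>\<^sup>+\<omega>. 0 \<partial>\<Omega>)"
    proof (intro nn_integral_dominated_convergence[where w = "\<lambda>_. 1"])
      show "tail n \<in> borel_measurable \<Omega>" for n
        using indep_rv_emeasure(2)[OF prob I_indep Q] by (cases "1 \<le> n") (simp_all add: tail_def[abs_def])
      show "AE \<omega> in \<Omega>. tail n \<omega> \<le> 1" for n
        by (simp add: tail_def emeasure_le_1)
    qed (simp_all add: emeasure_space_1)
    then have lim: "(\<lambda>n. \<integral>\<^sup>+\<omega>. tail n \<omega> \<partial>\<Omega>) \<longlonglongrightarrow> ennreal 0" by simp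
    have "\<forall>\<^sub>F n in sequentially. (\<integral>\<^sup>+\<omega>. tail n \<omega> \<partial>\<Omega>)
        = ennreal (measure \<Omega> {\<omega> \<in> space \<Omega>. \<bar>h n (D n \<omega>) (I n \<omega>)\<bar> > ereal \<epsilon>})"
      using eventually_ge_at_top[of 1]
    proof eventually_elim
      case (elim n)
      have "{\<omega> \<in> space \<Omega>. \<bar>h n (D n \<omega>) (I n \<omega>)\<bar> > ereal \<epsilon>}
          = {\<omega> \<in> space \<Omega>. ereal \<epsilon> < h n (D n \<omega>) (I n \<omega>)}"
        using h_nonneg[OF elim] by (simp add: abs_of_nonneg)
      then show ?case
        using indep_rv_emeasure(1)[OF prob I_indep[OF elim] Q[OF elim]] elim
        by (simp add: tail_def emeasure_eq_measure)
    qed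
    from Lim_transform_eventually[OF lim this]
    show "(\<lambda>n. measure \<Omega> {\<omega> \<in> space \<Omega>. \<bar>h n (D n \<omega>) (I n \<omega>)\<bar> > ereal \<epsilon>}) \<longlonglongrightarrow> 0"
      by (rule tendsto_ennrealD) simp_all
  qed
  moreover have "AE \<omega> in \<Omega>. (\<lambda>n. SUP M\<in>sizes s (bags n).
      deviation (data_risk (P n) (fhat n) (D n \<omega>) s (bags n) M) (?T M)) \<longlonglongrightarrow> 0"
  proof (rule AE_mp[OF good], rule AE_I2, rule impI, elim conjE)
    fix \<omega> assume \<omega>: "\<omega> \<in> space \<Omega>" and \<eta>: "(\<lambda>n. ?\<eta> n \<omega>) \<longlonglongrightarrow> 0"
      and unif: "\<forall>\<delta>>0. \<forall>\<^sub>F n in sequentially. \<forall>B\<in>bags n.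
        deviation (subsample_risk (P n) (fhat n) (D n \<omega>) 1 (\<lambda>_. B)) b1 \<le> ereal \<delta>"
    let ?H = "\<lambda>n. SUP M\<in>sizes s (bags n).
      deviation (data_risk (P n) (fhat n) (D n \<omega>) s (bags n) M) (?T M)"
    let ?H' = "\<lambda>n. if 1 \<le> n then ?H n else 0"
    have "?H' \<longlonglongrightarrow> 0"
    proof (rule tendsto_0_erealI)
      show "0 \<le> ?H' n" for n
        using SUP_upper2[OF size1 deviation_nonneg] by auto
      fix \<delta> :: real assume \<delta>: "0 < \<delta>"
      then have "\<forall>\<^sub>F n in sequentially. \<forall>B\<in>bags n.
          deviation (subsample_risk (P n) (fhat n) (D n \<omega>) 1 (\<lambda>_. B)) b1 \<le> ereal (\<delta> / 2)"
        using unif by simp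
      moreover have "\<forall>\<^sub>F n in sequentially. ?\<eta> n \<omega> < \<delta> / 2"
        by (rule order_tendstoD(2)[OF \<eta>]) (use \<delta> in simp)
      ultimately show "\<forall>\<^sub>F n in sequentially. ?H' n \<le> ereal \<delta>"
        using eventually_ge_at_top[of 1]
      proof eventually_elim
        case (elim n)
        have "?H n \<le> ereal (\<delta> / 2 + ?\<eta> n \<omega>)"
        proof (rule SUP_least)
          fix M assume M: "M \<in> sizes s (bags n)"
          show "deviation (data_risk (P n) (fhat n) (D n \<omega>) s (bags n) M) (?T M)
              \<le> ereal (\<delta> / 2 + ?\<eta> n \<omega>)"
            by (rule data_risk_deviation_le[OF I_sample[OF elim(3)] A[OF elim(3)] M
                  res[OF elim(3) \<omega>]]) (use elim in auto)
        qed
        also have "\<dots> \<le> ereal \<delta>" using elim(2) by simp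
        finally show ?case using elim(3) by simp
      qed
    qed
    then show "?H \<longlonglongrightarrow> 0"
      by (rule Lim_transform_eventually)
        (use eventually_ge_at_top[of 1] in \<open>eventually_elim, simp\<close>)
  qed
  ultimately show ?thesis by (simp only: h_def)
qed

end
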